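(* There exists a stationary stochastic process $\mathcal P$ whose classical statistical complexities in forward and reverse time differ, $C_\mu^+\neq C_\mu^-$, but whose quantum statistical complexities in forward and reverse time coincide, $C_q^+=C_q^-$.
   Context: A stochastic process $\mathcal P=P(\overleftarrow X,\overrightarrow X)$ is the law of a bi-infinite sequence $(X_t)_{t\in\mathbb Z}$ of discrete random variables, with past $\overleftarrow X=\dots X_{-2}X_{-1}$ and future $\overrightarrow X=X_0X_1\dots$. It is stationary if $P(X_{0:L})=P(X_{t:t+L})$ for all $L\in\mathbb Z^+$, $t\in\mathbb Z$, where $X_{t:t+L}=X_t\dots X_{t+L-1}$. The time-reversed process $\mathcal P^-$ is the law of $(Y_t)$ with $Y_t=X_{-(t+1)}$. Logarithms are base 2. Classical complexity: two pasts $\overleftarrow x,\overleftarrow x'$ are equivalent iff $P(\overrightarrow X|\overleftarrow X=\overleftarrow x)=P(\overrightarrow X|\overleftarrow X=\overleftarrow x')$. The equivalence classes $\{s_i\}$ (taken to be at most countably many) are the causal states, and $\pi_i=P(\overleftarrow X\in s_i)$. The classical statistical complexity is $C_\mu^+=-\sum_i\pi_i\log\pi_i$; $C_\mu^-$ is the same quantity computed for $\mathcal P^-$. Quantum complexity: a quantum (causal) model of $\mathcal P$ is a tuple $\mathcal Q=(f,\Omega,\mathcal M)$, where $\Omega$ is a set of pure states of a physical system $\Xi$, $f$ maps each past $\overleftarrow x$ to a state $f(\overleftarrow x)=|s_{\overleftarrow x}\rangle\in\Omega$, and $\mathcal M$ is a quantum measurement process (quantum instrument) on $\Xi$ such that,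 for every past $\overleftarrow x$, applying $\mathcal M$ to $\Xi$ in state $f(\overleftarrow x)$ (i) yields output $x$ with probability $P(X_0=x|\overleftarrow X=\overleftarrow x)$, and (ii) then leaves $\Xi$ in state $f(\overleftarrow x x)$, where $\overleftarrow xx$ is the past $\overleftarrow x$ with $x$ appended. Its entropy is $C_q(\mathcal Q)=S(\rho)=-\mathrm{Tr}(\rho\log\rho)$ with $\rho=\sum_{\overleftarrow x}P(\overleftarrow X=\overleftarrow x)|s_{\overleftarrow x}\rangle\langle s_{\overleftarrow x}|$ (average over the distribution of the past). The quantum statistical complexity $C_q^+$ is the minimum of $C_q(\mathcal Q)$ over all quantum models of $\mathcal P$; $C_q^-$ is the same quantity for $\mathcal P^-$. *)

theory Defs
  imports "HOL-Probability.Probability"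
begin

section \<open>Stochastic processes\<close>

definition process_space :: "(int \<Rightarrow> 'a::countable) measure" where
  "process_space = PiM UNIV (\<lambda>_. count_space UNIV)"

text \<open>One-sided sequences serve both as pasts and as futures. A past \<open>p\<close> is read backwards:
  \<open>p k\<close> is the symbol at time \<open>-1 - k\<close>.\<close>

definition seq_space :: "(nat \<Rightarrow> 'a::countable) measure" where
  "seq_space = PiM UNIV (\<lambda>_. count_space UNIV)"

definition past :: "(int \<Rightarrow> 'a) \<Rightarrow> nat \<Rightarrow> 'a" where
  "past \<omega> k = \<omega> (- 1 - int k)"

definition future :: "(int \<Rightarrow> 'a) \<Rightarrow> nat \<Rightarrow> 'a" where
  "future \<omega> k = \<omega> (int k)"

definition append_past :: "(nat \<Rightarrow> 'a) \<Rightarrow> 'a \<Rightarrow> nat \<Rightarrow> 'a" where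
  "append_past p x = case_nat x p"

definition stochastic_process :: "(int \<Rightarrow> 'a::countable) measure \<Rightarrow> bool" where
  "stochastic_process M \<longleftrightarrow> prob_space M \<and> sets M = sets process_space"

definition stationary :: "(int \<Rightarrow> 'a::countable) measure \<Rightarrow> bool" where
  "stationary M \<longleftrightarrow> (\<forall>(t::int) (w::'a list).
     measure M {\<omega> \<in> space M. \<forall>i<length w. \<omega> (t + int i) = w ! i}
   = measure M {\<omega> \<in> space M. \<forall>i<length w. \<omega> (int i) = w ! i})"

definition reverse_process :: "(int \<Rightarrow> 'a::countable) measure \<Rightarrow> (int \<Rightarrow> 'a) measure" where
  "reverse_process M = distr M process_space (\<lambda>\<omega> t. \<omega> (- (t + 1)))"

definition past_law :: "(int \<Rightarrow> 'a::countable) measure \<Rightarrow> (nat \<Rightarrow> 'a) measure" where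
  "past_law M = distr M seq_space past"

text \<open>A single past may have probability zero, so conditioning on it means a regular conditional
  distribution. It always exists here and is unique up to a null set of pasts; all notions below
  are insensitive to changing it on such a set.\<close>

definition regular_cond_future ::
    "(int \<Rightarrow> 'a::countable) measure \<Rightarrow> ((nat \<Rightarrow> 'a) \<Rightarrow> (nat \<Rightarrow> 'a) measure) \<Rightarrow> bool" where
  "regular_cond_future M \<kappa> \<longleftrightarrow>
     \<kappa> \<in> seq_space \<rightarrow>\<^sub>M prob_algebra seq_space \<and>
     (\<forall>A\<in>sets seq_space. \<forall>B\<in>sets seq_space.
        emeasure M {\<omega> \<in> space M. past \<omega> \<in> A \<and> future \<omega> \<in> B}
      = (\<integral>\<^sup>+p. emeasure (\<kappa> p) B * indicator A p \<partial>past_law M))"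

definition cond_future ::
    "(int \<Rightarrow> 'a::countable) measure \<Rightarrow> (nat \<Rightarrow> 'a) \<Rightarrow> (nat \<Rightarrow> 'a) measure" where
  "cond_future M = (SOME \<kappa>. regular_cond_future M \<kappa>)"

definition cond_next :: "(int \<Rightarrow> 'a::countable) measure \<Rightarrow> (nat \<Rightarrow> 'a) \<Rightarrow> 'a \<Rightarrow> real" where
  "cond_next M p x = measure (cond_future M p) {y \<in> space (cond_future M p). y 0 = x}"


section \<open>Classical statistical complexity\<close>

definition causal_states :: "(int \<Rightarrow> 'a::countable) measure \<Rightarrow> (nat \<Rightarrow> 'a) set set" where
  "causal_states M = UNIV // {(p, q). cond_future M p = cond_future M q}"

text \<open>Countability up to a null set of pasts, since \<^const>\<open>cond_future\<close> is arbitrary there.\<close>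

definition countably_many_causal_states :: "(int \<Rightarrow> 'a::countable) measure \<Rightarrow> bool" where
  "countably_many_causal_states M \<longleftrightarrow>
     (\<exists>S \<subseteq> causal_states M. countable S \<and> (AE p in past_law M. p \<in> \<Union>S))"

definition entropy_term :: "real \<Rightarrow> ennreal" where
  "entropy_term q = ennreal (- q * log 2 q)"

definition statistical_complexity :: "(int \<Rightarrow> 'a::countable) measure \<Rightarrow> ennreal" where
  "statistical_complexity M =
     (\<integral>\<^sup>+s. entropy_term (measure (past_law M) s) \<partial>count_space (causal_states M))"


section \<open>Quantum systems\<close>

text \<open>A separable Hilbert space of any finite or countable dimension, given in an orthonormal basis
  indexed by \<open>I\<close>.\<close>

definition ell2 :: "nat set \<Rightarrow> (nat \<Rightarrow> complex) set" where
  "ell2 I = {\<psi>. (\<forall>i. i \<notin> I \<longrightarrow> \<psi> i = 0) \<and> (\<lambda>i. (cmod (\<psi> i))\<^sup>2) summable_on UNIV}"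

definition ell2_inner :: "(nat \<Rightarrow> complex) \<Rightarrow> (nat \<Rightarrow> complex) \<Rightarrow> complex" where
  "ell2_inner \<phi> \<psi> = (\<Sum>\<^sub>\<infinity>i. cnj (\<phi> i) * \<psi> i)"

definition ell2_norm_sq :: "(nat \<Rightarrow> complex) \<Rightarrow> real" where
  "ell2_norm_sq \<psi> = (\<Sum>\<^sub>\<infinity>i. (cmod (\<psi> i))\<^sup>2)"

definition pure_states :: "nat set \<Rightarrow> (nat \<Rightarrow> complex) set" where
  "pure_states I = {\<psi> \<in> ell2 I. ell2_norm_sq \<psi> = 1}"

definition ell2_operator :: "nat set \<Rightarrow> ((nat \<Rightarrow> complex) \<Rightarrow> (nat \<Rightarrow> complex)) \<Rightarrow> bool" where
  "ell2_operator I T \<longleftrightarrow>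
     (\<forall>\<psi>\<in>ell2 I. T \<psi> \<in> ell2 I) \<and>
     (\<forall>\<phi>\<in>ell2 I. \<forall>\<psi>\<in>ell2 I. T (\<lambda>i. \<phi> i + \<psi> i) = (\<lambda>i. T \<phi> i + T \<psi> i)) \<and>
     (\<forall>c. \<forall>\<psi>\<in>ell2 I. T (\<lambda>i. c * \<psi> i) = (\<lambda>i. c * T \<psi> i))"

text \<open>A quantum instrument in Kraus form: on outcome \<open>x\<close> a state \<open>\<sigma>\<close> is mapped to
  \<open>\<Sum>j. K x j \<sigma> (K x j)\<^sup>*\<close>, unnormalised, so that its trace is the probability of \<open>x\<close>. The last
  condition says \<open>\<Sum>x j. (K x j)\<^sup>* K x j = 1\<close>, which also makes every \<open>K x j\<close> bounded.\<close>

definition quantum_instrument ::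
    "nat set \<Rightarrow> ('a \<Rightarrow> nat \<Rightarrow> (nat \<Rightarrow> complex) \<Rightarrow> (nat \<Rightarrow> complex)) \<Rightarrow> bool" where
  "quantum_instrument I K \<longleftrightarrow>
     (\<forall>x j. ell2_operator I (K x j)) \<and>
     (\<forall>\<psi>\<in>ell2 I. ((\<lambda>(x, j). ell2_norm_sq (K x j \<psi>)) has_sum ell2_norm_sq \<psi>) UNIV)"

text \<open>Operators are represented by their matrices in the standard basis. Indexing
  the eigenvectors by \<open>I\<close> loses nothing, as an orthonormal basis has the cardinality of \<open>I\<close>; eigenvectors
  for eigenvalue \<open>0\<close> need not be exhausted.\<close>

definition spectral_decomposition ::
    "nat set \<Rightarrow> (nat \<Rightarrow> nat \<Rightarrow> complex) \<Rightarrow> (nat \<Rightarrow> nat \<Rightarrow> complex) \<Rightarrow> (nat \<Rightarrow> real) \<Rightarrow> bool" where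
  "spectral_decomposition I \<rho> e \<mu> \<longleftrightarrow>
     (\<forall>k\<in>I. e k \<in> ell2 I \<and> 0 \<le> \<mu> k) \<and>
     (\<forall>k\<in>I. \<forall>l\<in>I. ell2_inner (e k) (e l) = (if k = l then 1 else 0)) \<and>
     (\<forall>a b. ((\<lambda>k. of_real (\<mu> k) * e k a * cnj (e k b)) has_sum \<rho> a b) I)"

text \<open>The value \<open>-Tr(\<rho> log \<rho>)\<close>, with \<open>\<rho> log \<rho>\<close> evaluated in an eigenbasis. Every density operator
  has a spectral decomposition, and all of them have the same non-zero eigenvalues with the same
  multiplicities, so the infimum merely picks the common value.\<close>

definition von_neumann_entropy :: "nat set \<Rightarrow> (nat \<Rightarrow> nat \<Rightarrow> complex) \<Rightarrow> ennreal" where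
  "von_neumann_entropy I \<rho> =
     Inf {(\<integral>\<^sup>+k. entropy_term (\<mu> k) \<partial>count_space I) | e \<mu>. spectral_decomposition I \<rho> e \<mu>}"


section \<open>Quantum statistical complexity\<close>

record 'a qmodel =
  system :: "nat set"
  encoding :: "(nat \<Rightarrow> 'a) \<Rightarrow> (nat \<Rightarrow> complex)"
  memory_states :: "(nat \<Rightarrow> complex) set"
  kraus :: "'a \<Rightarrow> nat \<Rightarrow> (nat \<Rightarrow> complex) \<Rightarrow> (nat \<Rightarrow> complex)"

text \<open>The last two conjuncts are the output statistics and the update rule; the latter equates the
  unnormalised state after outcome \<open>x\<close> with the probability of \<open>x\<close> times the projector onto the
  encoding of the extended past. They are imposed on almost every past because the conditional
  probabilities are determined only up to null sets. Measurability of the encoding is needed for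
  the average state to exist.\<close>

definition quantum_model :: "(int \<Rightarrow> 'a::countable) measure \<Rightarrow> 'a qmodel \<Rightarrow> bool" where
  "quantum_model M Q \<longleftrightarrow>
     memory_states Q \<subseteq> pure_states (system Q) \<and>
     (\<forall>p. encoding Q p \<in> memory_states Q) \<and>
     (\<forall>i. (\<lambda>p. encoding Q p i) \<in> borel_measurable seq_space) \<and>
     quantum_instrument (system Q) (kraus Q) \<and>
     (AE p in past_law M. \<forall>x.
        ((\<lambda>j. ell2_norm_sq (kraus Q x j (encoding Q p))) has_sum cond_next M p x) UNIV \<and>
        (\<forall>a b. ((\<lambda>j. kraus Q x j (encoding Q p) a * cnj (kraus Q x j (encoding Q p) b)) has_sum
           of_real (cond_next M p x) *
             (encoding Q (append_past p x) a * cnj (encoding Q (append_past p x) b))) UNIV))"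

definition average_state ::
    "(int \<Rightarrow> 'a::countable) measure \<Rightarrow> 'a qmodel \<Rightarrow> nat \<Rightarrow> nat \<Rightarrow> complex" where
  "average_state M Q a b = (\<integral>p. encoding Q p a * cnj (encoding Q p b) \<partial>past_law M)"

definition model_entropy :: "(int \<Rightarrow> 'a::countable) measure \<Rightarrow> 'a qmodel \<Rightarrow> ennreal" where
  "model_entropy M Q = von_neumann_entropy (system Q) (average_state M Q)"

definition is_quantum_complexity :: "(int \<Rightarrow> 'a::countable) measure \<Rightarrow> ennreal \<Rightarrow> bool" where
  "is_quantum_complexity M c \<longleftrightarrow>
     (\<exists>Q. quantum_model M Q \<and> model_entropy M Q = c) \<and>
     (\<forall>Q. quantum_model M Q \<longrightarrow> c \<le> model_entropy M Q)"

end

(* Let b be a bi-infinite sequence of fair coin flips and let X_t = 2 if b_t = 1, and otherwise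
   X_t = 0 or 1 according to whether b_(t-1) = 1 or 0.  The last symbol of a past determines the
   bit b_(-1), so that there are two causal states, of probability 1/2 each.  In reverse time the
   symbols 0 and 1 reveal the bit b_(t-1), while 2 leaves it undetermined, and there are three
   causal states, of probabilities 1/4, 1/4 and 1/2.  The classical complexities are 1 and 3/2.

   In both directions X is a Markov chain.  Its quantum model with memory states
   sum_x sqrt (T i x) |x>, where i is the last symbol and T the transition matrix, has average
   state A^T A, where A i x is the square root of the probability of the pair (i, x).  Time
   reversal transposes A, which preserves the spectrum, here 3/4, 1/4, 0.

   Conversely, let mu be an eigenvalue of the average state of any model.  The isometry underlying
   the measurement and the prescribed output statistics bound the norm of a linear combination
   sum_i c_i psi_i of memory states psi_i of pasts ending in i by the norm of A^T applied to the
   vector |c_i| / sqrt (P(i)).  Hence mu is at most the largest eigenvalue 3/4 of A A^T.  A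
   probability distribution with all weights at most 3/4 has at least the entropy of (3/4, 1/4). *)

theory Submission imports Defs begin

section \<open>The process and its laws conditioned on one bit\<close>

text \<open>A cap on the largest eigenvalue is enough because the average state of the Markov model
  has rank two: in forward time, pasts ending in 0 and in 1 share one memory state. With trace one,
  the top eigenvalue then fixes the whole spectrum, and transposition carries rank two over to
  reverse time. For an arbitrary model there are three obstacles. Pasts with the same last symbol
  may have different memory states, every single past has probability zero, and the system may be
  infinite-dimensional. Hence the norm inequality is proved for one representative past per symbol
  and then integrated over the representatives, and eigenvectors are tested through finite
  truncations. Moreover \<open>cond_future\<close> is an unspecified choice among kernels that agree
  only almost surely, so it is accessible only through an explicit kernel and almost sure
  uniqueness; its values on a null set of pasts may create further causal states.\<close>

abbreviation coin :: "bool measure" where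
  "coin \<equiv> measure_pmf (bernoulli_pmf (1/2))"

abbreviation coins :: "(nat \<Rightarrow> bool) measure" where
  "coins \<equiv> PiM UNIV (\<lambda>_. coin)"

text \<open>The argument \<open>b\<close> is the bit at the time of the symbol and \<open>a\<close>
  the bit one step earlier.\<close>

definition symbol :: "bool \<Rightarrow> bool \<Rightarrow> nat" where
  "symbol a b = (if b then 2 else if a then 0 else 1)"

definition coin_process :: "(int \<Rightarrow> nat) measure" where
  "coin_process = distr (PiM UNIV (\<lambda>_. coin)) process_space (\<lambda>b t. symbol (b (t - 1)) (b t))"

text \<open>Conditioned on the bit \<open>u\<close> at time \<open>-1\<close>, past and future are independent. In \<open>past_given\<close>,
  \<open>U k\<close> is the bit at time \<open>-2 - k\<close>; in \<open>future_given\<close>, \<open>V k\<close> is the bit at time \<open>k\<close>.\<close>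

definition past_given :: "bool \<Rightarrow> (nat \<Rightarrow> nat) measure" where
  "past_given u = distr coins seq_space
     (\<lambda>U k. symbol (U k) (case_nat u U k))"

definition future_given :: "bool \<Rightarrow> (nat \<Rightarrow> nat) measure" where
  "future_given u = distr coins seq_space
     (\<lambda>V k. symbol (case_nat u V k) (V k))"

section \<open>Measurability on the sequence spaces, and stationarity\<close>

lemma space_process_space [simp]: "space process_space = UNIV"
  by (simp add: process_space_def space_PiM)

lemma space_seq_space [simp]: "space seq_space = UNIV"
  by (simp add: seq_space_def space_PiM)

lemma measurable_into_seq_space:
  assumes "\<And>k. (\<lambda>x. f x k) \<in> N \<rightarrow>\<^sub>M count_space UNIV"
  shows "f \<in> N \<rightarrow>\<^sub>M seq_space"
  unfolding seq_space_def using assms by (intro measurable_PiM_single') auto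

lemma measurable_into_process_space:
  assumes "\<And>t. (\<lambda>x. f x t) \<in> N \<rightarrow>\<^sub>M count_space UNIV"
  shows "f \<in> N \<rightarrow>\<^sub>M process_space"
  unfolding process_space_def using assms by (intro measurable_PiM_single') auto

lemma measurable_seq_component [measurable]:
  "(\<lambda>y. y k) \<in> seq_space \<rightarrow>\<^sub>M count_space UNIV"
  unfolding seq_space_def by (rule measurable_component_singleton) simp

lemma measurable_process_component [measurable]:
  "(\<lambda>\<omega>. \<omega> t) \<in> process_space \<rightarrow>\<^sub>M count_space UNIV"
  unfolding process_space_def by (rule measurable_component_singleton) simp

lemma measurable_past [measurable]: "past \<in> process_space \<rightarrow>\<^sub>M seq_space"
  by (rule measurable_into_seq_space) (simp add: past_def)

lemma measurable_future [measurable]: "future \<in> process_space \<rightarrow>\<^sub>M seq_space"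
  by (rule measurable_into_seq_space) (simp add: future_def)

lemma measurable_coins_component [measurable]:
  "(\<lambda>U. U k) \<in> PiM UNIV (\<lambda>_. coin) \<rightarrow>\<^sub>M count_space UNIV"
  using measurable_component_singleton[of k UNIV "\<lambda>_. coin"] by (simp cong: measurable_cong_sets)

lemma measurable_symbol [measurable]:
  assumes [measurable]: "f \<in> N \<rightarrow>\<^sub>M count_space UNIV" "g \<in> N \<rightarrow>\<^sub>M count_space UNIV"
  shows "(\<lambda>x. symbol (f x) (g x)) \<in> N \<rightarrow>\<^sub>M count_space UNIV"
  unfolding symbol_def by measurable

lemma prob_space_coins: "prob_space (PiM UNIV (\<lambda>_. coin))"
  by (intro prob_space_PiM measure_pmf.prob_space_axioms)

interpretation coins: sequence_space coin
  by unfold_locales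

lemma measurable_sliding:
  "(\<lambda>b t. symbol (b (t - 1)) (b t)) \<in> PiM UNIV (\<lambda>_. coin) \<rightarrow>\<^sub>M process_space"
  by (rule measurable_into_process_space) measurable

lemma stochastic_coin_process: "stochastic_process coin_process"
  unfolding stochastic_process_def coin_process_def
  using prob_space.prob_space_distr[OF prob_space_coins measurable_sliding] by simp

text \<open>The law of the bits is invariant under translation of the index, and the map from bits
  to symbols commutes with translations.\<close>

lemma stationary_coin_process: "stationary coin_process"
  unfolding stationary_def
proof (intro allI)
  fix t :: int and w :: "nat list"
  let ?B = "PiM UNIV (\<lambda>_::int. coin)"
  let ?f = "\<lambda>b t. symbol (b (t - 1)) (b (t::int))"
  have m: "{\<omega>::int\<Rightarrow>nat. \<forall>i<length w. \<omega> (s + int i) = w ! i} \<in> sets process_space" for s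
  proof -
    have "{\<omega>::int\<Rightarrow>nat \<in> space process_space. \<forall>i<length w. \<omega> (s + int i) = w ! i} \<in> sets process_space"
      by measurable
    then show ?thesis by simp
  qed
  have e: "measure coin_process {\<omega> \<in> space coin_process. \<forall>i<length w. \<omega> (s + int i) = w ! i}
      = measure ?B {b \<in> space ?B. \<forall>i<length w. symbol (b (s + int i - 1)) (b (s + int i)) = w ! i}" for s
    unfolding coin_process_def
    by (simp add: measure_distr[OF measurable_sliding m] vimage_def Int_def conj_commute)
  have sh: "distr ?B ?B (\<lambda>b n. b (n + t)) = ?B"
    using distr_PiM_reindex[of UNIV "\<lambda>_. coin" "\<lambda>n. n + t" UNIV]
    by (simp add: measure_pmf.prob_space_axioms restrict_def)
  have shm: "(\<lambda>b n. b (n + t)) \<in> ?B \<rightarrow>\<^sub>M ?B"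
    by (rule measurable_PiM_single') (auto simp: measurable_coins_component cong: measurable_cong_sets)
  have m2: "{b \<in> space ?B. \<forall>i<length w. symbol (b (int i - 1)) (b (int i)) = w ! i} \<in> sets ?B"
    by measurable
  have "measure ?B {b \<in> space ?B. \<forall>i<length w. symbol (b (t + int i - 1)) (b (t + int i)) = w ! i}
    = measure ?B {b \<in> space ?B. \<forall>i<length w. symbol (b (int i - 1)) (b (int i)) = w ! i}"
    by (subst (2) sh[symmetric], subst measure_distr[OF shm m2])
       (simp add: vimage_def Int_def space_PiM algebra_simps)
  with e[of t] e[of 0]
  show "measure coin_process {\<omega> \<in> space coin_process. \<forall>i<length w. \<omega> (t + int i) = w ! i}
      = measure coin_process {\<omega> \<in> space coin_process. \<forall>i<length w. \<omega> (int i) = w ! i}"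
    by simp
qed

section \<open>Splitting the bits into past and future\<close>

lemma measurable_case_int:
  assumes "f \<in> N \<rightarrow>\<^sub>M coins" "h \<in> N \<rightarrow>\<^sub>M coins"
  shows "(\<lambda>x t::int. if t < 0 then f x (nat (- 1 - t)) else h x (nat t)) \<in> N \<rightarrow>\<^sub>M PiM UNIV (\<lambda>_. coin)"
proof (rule measurable_PiM_single')
  fix t :: int
  have "(\<lambda>x. f x k) \<in> N \<rightarrow>\<^sub>M coin" "(\<lambda>x. h x k) \<in> N \<rightarrow>\<^sub>M coin" for k
    using assms[THEN measurable_compose, OF measurable_component_singleton[of k]] by simp_all
  then show "(\<lambda>x. if t < 0 then f x (nat (- 1 - t)) else h x (nat t)) \<in> N \<rightarrow>\<^sub>M coin"
    by (cases "t < 0") simp_all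
qed simp

text \<open>A product measure is determined by its values on finite boxes, and a box over integer
  times is the product of a box over negative times, read backwards, and a box over nonnegative
  times.\<close>

lemma coins_split:
  "distr (coins \<Otimes>\<^sub>M coins) (PiM UNIV (\<lambda>_. coin))
     (\<lambda>(U, V) t::int. if t < 0 then U (nat (- 1 - t)) else V (nat t)) = PiM UNIV (\<lambda>_. coin)"
  (is "distr _ _ ?f = _")
proof (rule product_prob_space.PiM_eq)
  show "product_prob_space (\<lambda>_::int. coin)" by unfold_locales
next
  fix J :: "int set" and E assume J: "finite J" "\<And>j. j \<in> J \<Longrightarrow> E j \<in> sets coin"
  let ?X = "prod_emb UNIV (\<lambda>_. coin) J (\<Pi>\<^sub>E j\<in>J. E j)"
  let ?J1 = "(\<lambda>k. - 1 - int k) -` J" and ?J2 = "int -` J"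
  let ?E1 = "prod_emb UNIV (\<lambda>_. coin) ?J1 (\<Pi>\<^sub>E k\<in>?J1. E (- 1 - int k))"
  let ?E2 = "prod_emb UNIV (\<lambda>_. coin) ?J2 (\<Pi>\<^sub>E k\<in>?J2. E (int k))"
  have f: "finite ?J1" "finite ?J2"
    using J by (auto intro!: finite_vimageI simp: inj_on_def)
  have m: "?f \<in> coins \<Otimes>\<^sub>M coins \<rightarrow>\<^sub>M PiM UNIV (\<lambda>_. coin)"
    using measurable_case_int[OF measurable_fst measurable_snd] by (simp add: case_prod_beta')
  have "?f -` ?X \<inter> space (coins \<Otimes>\<^sub>M coins) = ?E1 \<times> ?E2"
  proof (rule set_eqI, clarify)
    fix U V :: "nat \<Rightarrow> bool"
    have "(\<forall>j\<in>J. (if j < 0 then U (nat (- 1 - j)) else V (nat j)) \<in> E j) \<longleftrightarrow>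
        (\<forall>k\<in>?J1. U k \<in> E (- 1 - int k)) \<and> (\<forall>k\<in>?J2. V k \<in> E (int k))"
      (is "?l \<longleftrightarrow> ?r")
    proof
      assume l: ?l
      show ?r
      proof (intro conjI ballI)
        fix k assume "k \<in> ?J1"
        then show "U k \<in> E (- 1 - int k)" using l[rule_format, of "- 1 - int k"] by simp
      next
        fix k assume "k \<in> ?J2"
        then show "V k \<in> E (int k)" using l[rule_format, of "int k"] by simp
      qed
    next
      assume r: ?r
      show ?l
      proof
        fix j assume "j \<in> J"
        then show "(if j < 0 then U (nat (- 1 - j)) else V (nat j)) \<in> E j"
          using r[THEN conjunct1, rule_format, of "nat (- 1 - j)"]
            r[THEN conjunct2, rule_format, of "nat j"] by auto
      qed
    qed
    then show "(U, V) \<in> ?f -` ?X \<inter> space (coins \<Otimes>\<^sub>M coins) \<longleftrightarrow> (U, V) \<in> ?E1 \<times> ?E2"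
      by (simp add: prod_emb_def space_pair_measure space_PiM restrict_PiE_iff Pi_iff)
  qed
  then have "emeasure (distr (coins \<Otimes>\<^sub>M coins) (PiM UNIV (\<lambda>_. coin)) ?f) ?X
      = emeasure (coins \<Otimes>\<^sub>M coins) (?E1 \<times> ?E2)"
    using J by (subst emeasure_distr[OF m]) (auto intro!: sets_PiM_I)
  also have "\<dots> = emeasure coins ?E1 * emeasure coins ?E2"
    using J f by (intro coins.P.emeasure_pair_measure_Times) (auto intro!: sets_PiM_I)
  also have "emeasure coins ?E1 = (\<Prod>k\<in>?J1. emeasure coin (E (- 1 - int k)))"
    using J f by (intro coins.emeasure_PiM_emb) auto
  also have "\<dots> = (\<Prod>j\<in>J \<inter> {..<0}. emeasure coin (E j))"
    by (rule prod.reindex_bij_witness[of _ "\<lambda>j. nat (- 1 - j)" "\<lambda>k. - 1 - int k"]) auto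
  also have "emeasure coins ?E2 = (\<Prod>k\<in>?J2. emeasure coin (E (int k)))"
    using J f by (intro coins.emeasure_PiM_emb) auto
  also have "\<dots> = (\<Prod>j\<in>J - {..<0}. emeasure coin (E j))"
    by (rule prod.reindex_bij_witness[of _ nat int]) auto
  also have "(\<Prod>j\<in>J \<inter> {..<0}. emeasure coin (E j)) * (\<Prod>j\<in>J - {..<0}. emeasure coin (E j))
     = (\<Prod>j\<in>J. emeasure coin (E j))"
    by (rule prod.Int_Diff[symmetric]) fact
  finally show "emeasure (distr (coins \<Otimes>\<^sub>M coins) (PiM UNIV (\<lambda>_. coin)) ?f) ?X
      = (\<Prod>j\<in>J. emeasure coin (E j))" .
qed simp_all

lemma measurable_case_nat_coins [measurable]:
  "case_nat u \<in> coins \<rightarrow>\<^sub>M coins"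
proof (rule measurable_PiM_single')
  fix k show "(\<lambda>x. case_nat u x k) \<in> coins \<rightarrow>\<^sub>M coin"
    by (cases k) (simp_all add: measurable_component_singleton)
qed simp

text \<open>Fubini after splitting off the first coin. When \<open>U\<close> lists the bits of the
  past backwards from time -1, this conditions on the bit at time -1.\<close>

lemma nn_integral_coins_case_nat:
  assumes [measurable]: "h \<in> borel_measurable coins"
  shows "(\<integral>\<^sup>+U. h U \<partial>coins)
    = (\<integral>\<^sup>+U. h (case_nat True U) \<partial>coins) / 2 + (\<integral>\<^sup>+U. h (case_nat False U) \<partial>coins) / 2"
proof -
  have m: "(\<lambda>(s, \<omega>). case_nat s \<omega>) \<in> coin \<Otimes>\<^sub>M coins \<rightarrow>\<^sub>M coins"
    by (rule measurable_PiM_single')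
       (auto simp: case_prod_beta' split: nat.split intro!: measurable_compose[OF measurable_snd])
  have "(\<integral>\<^sup>+U. h U \<partial>coins) = (\<integral>\<^sup>+x. h (case_nat (fst x) (snd x)) \<partial>(coin \<Otimes>\<^sub>M coins))"
    by (subst coins.PiM_iter[symmetric], subst nn_integral_distr[OF m])
       (simp_all add: case_prod_beta')
  also have "\<dots> = (\<integral>\<^sup>+u. \<integral>\<^sup>+U. h (case_nat u U) \<partial>coins \<partial>coin)"
    using m by (subst coins.P.nn_integral_fst[symmetric]) (auto simp: case_prod_beta')
  also have "\<dots> = (\<integral>\<^sup>+U. h (case_nat True U) \<partial>coins) / 2 + (\<integral>\<^sup>+U. h (case_nat False U) \<partial>coins) / 2"
    by (simp add: ennreal_divide_numeral divide_ennreal_def)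
  finally show ?thesis .
qed

lemma measurable_past_given:
  "(\<lambda>U k. symbol (U k) (case_nat u U k)) \<in> coins \<rightarrow>\<^sub>M seq_space"
proof (rule measurable_into_seq_space)
  fix k show "(\<lambda>U. symbol (U k) (case_nat u U k)) \<in> coins \<rightarrow>\<^sub>M count_space UNIV"
    by (cases k) auto
qed

lemma measurable_future_given:
  "(\<lambda>V k. symbol (case_nat u V k) (V k)) \<in> coins \<rightarrow>\<^sub>M seq_space"
proof (rule measurable_into_seq_space)
  fix k show "(\<lambda>V. symbol (case_nat u V k) (V k)) \<in> coins \<rightarrow>\<^sub>M count_space UNIV"
    by (cases k) auto
qed

lemma past_given_in_prob_algebra: "past_given u \<in> space (prob_algebra seq_space)"
  unfolding past_given_def space_prob_algebra
  by (auto intro!: coins.P.prob_space_distr measurable_past_given)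

lemma future_given_in_prob_algebra: "future_given u \<in> space (prob_algebra seq_space)"
  unfolding future_given_def space_prob_algebra
  by (auto intro!: coins.P.prob_space_distr measurable_future_given)

text \<open>Symbols at negative times depend on the bits up to time -1, symbols at later times on
  the bits from time -1 on. The two sides share only the bit at time -1, and summing over it gives
  the two products.\<close>

lemma coin_process_joint:
  assumes [measurable]: "A \<in> sets seq_space" "B \<in> sets seq_space"
  shows "emeasure coin_process {\<omega> \<in> space coin_process. past \<omega> \<in> A \<and> future \<omega> \<in> B}
    = emeasure (past_given True) A * emeasure (future_given True) B / 2
      + emeasure (past_given False) A * emeasure (future_given False) B / 2"
proof -
  let ?f = "\<lambda>(U, V) t::int. if t < 0 then U (nat (- 1 - t)) else V (nat t)"
  \<comment> \<open>Here \<open>U k\<close> is the bit at time -1 - k, so the earlier bit has the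
    larger index; once \<open>U 0\<close> is split off, the indices are those of
    \<open>past_given\<close>.\<close>
  let ?P = "\<lambda>U k. symbol (U (Suc k)) (U k)"
  let ?F = "\<lambda>u V k. symbol (case_nat u V k) (V k)"
  let ?B = "PiM UNIV (\<lambda>_::int. coin)"
  let ?h = "\<lambda>U V. indicator A (?P U) * indicator B (?F (U 0) V) :: ennreal"
  have mf: "?f \<in> coins \<Otimes>\<^sub>M coins \<rightarrow>\<^sub>M ?B"
    using measurable_case_int[OF measurable_fst measurable_snd] by (simp add: case_prod_beta')
  have mP [measurable]: "?P \<in> coins \<rightarrow>\<^sub>M seq_space"
    by (rule measurable_into_seq_space) measurable
  have mF: "(\<lambda>x. ?F (fst x 0) (snd x)) \<in> coins \<Otimes>\<^sub>M coins \<rightarrow>\<^sub>M seq_space"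
  proof (rule measurable_into_seq_space)
    fix k show "(\<lambda>x. ?F (fst x 0) (snd x) k) \<in> coins \<Otimes>\<^sub>M coins \<rightarrow>\<^sub>M count_space UNIV"
      by (cases k) auto
  qed
  note mF [measurable]
  note measurable_future_given [measurable]
  let ?b = "\<lambda>x t. symbol (?f x (t - 1)) (?f x t)"
  have pb: "past (?b (U, V)) = ?P U" for U V
  proof
    fix k
    have "nat (- 1 - (- 1 - int k - 1)) = Suc k" "nat (- 1 - (- 1 - int k)) = k" by linarith+
    then show "past (?b (U, V)) k = ?P U k" by (simp add: past_def)
  qed
  have fb: "future (?b (U, V)) = ?F (U 0) V" for U V
  proof
    fix k
    have "nat (1 + int m) = Suc m" for m by linarith
    then show "future (?b (U, V)) k = ?F (U 0) V k"
      by (cases k) (simp_all add: future_def)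
  qed
  have mb: "?b \<in> coins \<Otimes>\<^sub>M coins \<rightarrow>\<^sub>M process_space"
    using measurable_compose[OF mf measurable_sliding] by simp
  have cp: "coin_process = distr (coins \<Otimes>\<^sub>M coins) process_space ?b"
    unfolding coin_process_def
    by (subst coins_split[symmetric], subst distr_distr[OF measurable_sliding mf]) (simp add: comp_def)
  have "{\<omega>::int \<Rightarrow> nat. past \<omega> \<in> A \<and> future \<omega> \<in> B} = {\<omega> \<in> space process_space. past \<omega> \<in> A \<and> future \<omega> \<in> B}"
    by simp
  also have "\<dots> \<in> sets process_space" by measurable
  finally have ms: "{\<omega>::int \<Rightarrow> nat. past \<omega> \<in> A \<and> future \<omega> \<in> B} \<in> sets process_space" .
  have "emeasure coin_process {\<omega> \<in> space coin_process. past \<omega> \<in> A \<and> future \<omega> \<in> B}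
      = (\<integral>\<^sup>+\<omega>. indicator {\<omega>. past \<omega> \<in> A \<and> future \<omega> \<in> B} \<omega> \<partial>coin_process)"
    using ms by (simp add: cp)
  also have "\<dots> = (\<integral>\<^sup>+x. ?h (fst x) (snd x) \<partial>(coins \<Otimes>\<^sub>M coins))"
  proof -
    have "indicator {\<omega>. past \<omega> \<in> A \<and> future \<omega> \<in> B} (?b x) = ?h (fst x) (snd x)" for x
    proof (cases x)
      case (Pair U V)
      show ?thesis
        unfolding Pair indicator_def mem_Collect_eq pb fb fst_conv snd_conv by simp
    qed
    then show ?thesis
      unfolding cp using ms by (subst nn_integral_distr[OF mb]) (simp_all only: borel_measurable_indicator sets_distr)
  qed
  also have "\<dots> = (\<integral>\<^sup>+U. \<integral>\<^sup>+V. ?h U V \<partial>coins \<partial>coins)"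
    by (subst coins.P.nn_integral_fst[symmetric]) (measurable, simp only: fst_conv snd_conv)
  also have "\<dots> = (\<integral>\<^sup>+U. indicator A (?P U) * emeasure (future_given (U 0)) B \<partial>coins)"
  proof (rule nn_integral_cong)
    fix U
    have "(\<integral>\<^sup>+V. ?h U V \<partial>coins) = indicator A (?P U) * (\<integral>\<^sup>+V. indicator B (?F (U 0) V) \<partial>coins)"
      by (subst nn_integral_cmult) simp_all
    also have "(\<integral>\<^sup>+V. indicator B (?F (U 0) V) \<partial>coins) = emeasure (future_given (U 0)) B"
      using nn_integral_distr[OF measurable_future_given, of "indicator B" "U 0"]
      by (simp add: future_given_def)
    finally show "(\<integral>\<^sup>+V. ?h U V \<partial>coins) = indicator A (?P U) * emeasure (future_given (U 0)) B" .
  qed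
  also have "\<dots> = emeasure (past_given True) A * emeasure (future_given True) B / 2
      + emeasure (past_given False) A * emeasure (future_given False) B / 2"
  proof -
    have "(\<lambda>U. emeasure (future_given (U 0)) B) \<in> borel_measurable coins"
      by (rule measurable_compose[OF measurable_coins_component]) simp
    note [measurable] = this measurable_past_given
    have e: "(\<integral>\<^sup>+U. indicator A (?P (case_nat u U)) * emeasure (future_given (case_nat u U 0)) B \<partial>coins)
      = emeasure (past_given u) A * emeasure (future_given u) B" for u
    proof -
      have "(\<integral>\<^sup>+U. indicator A (?P (case_nat u U)) * emeasure (future_given (case_nat u U 0)) B \<partial>coins)
        = (\<integral>\<^sup>+U. indicator A (\<lambda>k. symbol (U k) (case_nat u U k)) * emeasure (future_given u) B \<partial>coins)"
        by simp
      also have "\<dots> = (\<integral>\<^sup>+U. indicator A (\<lambda>k. symbol (U k) (case_nat u U k)) \<partial>coins) * emeasure (future_given u) B"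
        by (rule nn_integral_multc) simp
      also have "(\<integral>\<^sup>+U. indicator A (\<lambda>k. symbol (U k) (case_nat u U k)) \<partial>coins) = emeasure (past_given u) A"
        using nn_integral_distr[OF measurable_past_given, of "indicator A" u]
        by (simp add: past_given_def)
      finally show ?thesis .
    qed
    show ?thesis
      by (subst nn_integral_coins_case_nat) (simp_all only: e, measurable)
  qed
  finally show ?thesis .
qed

section \<open>Laws of pasts, kernels depending on the last symbol, and time reversal\<close>

lemma measurable_stochastic_process_component:
  "stochastic_process M \<Longrightarrow> (\<lambda>\<omega>. \<omega> t) \<in> M \<rightarrow>\<^sub>M count_space UNIV"
  unfolding stochastic_process_def
  using measurable_process_component by (metis measurable_cong_sets)

lemma emeasure_past_law:
  assumes "stochastic_process M" "A \<in> sets seq_space"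
  shows "emeasure (past_law M) A = emeasure M {\<omega> \<in> space M. past \<omega> \<in> A}"
proof -
  have "past \<in> M \<rightarrow>\<^sub>M seq_space"
    using assms(1) measurable_past by (simp add: stochastic_process_def cong: measurable_cong_sets)
  then show ?thesis
    using assms(2) by (simp add: past_law_def emeasure_distr vimage_def Int_def conj_commute)
qed

lemma sets_past_law [simp]: "sets (past_law M) = sets seq_space"
  by (simp add: past_law_def)

lemma space_past_law [simp]: "space (past_law M) = UNIV"
  by (simp add: past_law_def)

lemma prob_space_past_law:
  assumes "stochastic_process M"
  shows "prob_space (past_law M)"
proof -
  have "past \<in> M \<rightarrow>\<^sub>M seq_space"
    using assms measurable_past by (simp add: stochastic_process_def cong: measurable_cong_sets)
  then show ?thesis
    using assms unfolding past_law_def by (auto intro: prob_space.prob_space_distr simp: stochastic_process_def)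
qed

lemma measurable_Int_first:
  assumes [measurable]: "A \<in> sets seq_space"
  shows "A \<inter> {p. p 0 = i} \<in> sets seq_space"
proof -
  have "{p \<in> space seq_space. p \<in> A \<and> p 0 = i} \<in> sets seq_space" by measurable
  then show ?thesis by (simp add: Int_def)
qed

text \<open>For a kernel that depends on the last symbol only, the integral over pasts collapses to
  a finite sum over the values of that symbol.\<close>

lemma regular_cond_futureI:
  fixes M :: "(int \<Rightarrow> 'a::countable) measure"
  assumes M: "stochastic_process M" and fin: "finite S"
    and \<nu>: "\<And>i. \<nu> i \<in> space (prob_algebra seq_space)"
    and AE: "AE p in past_law M. p 0 \<in> S"
    and eq: "\<And>A B. A \<in> sets seq_space \<Longrightarrow> B \<in> sets seq_space \<Longrightarrow>
      emeasure M {\<omega> \<in> space M. past \<omega> \<in> A \<and> future \<omega> \<in> B}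
        = (\<Sum>i\<in>S. emeasure (\<nu> i) B * emeasure (past_law M) (A \<inter> {p. p 0 = i}))"
  shows "regular_cond_future M (\<lambda>p. \<nu> (p 0))"
  unfolding regular_cond_future_def
proof (intro conjI ballI)
  show "(\<lambda>p. \<nu> (p 0)) \<in> seq_space \<rightarrow>\<^sub>M prob_algebra seq_space"
    by (rule measurable_compose[OF measurable_seq_component]) (simp add: \<nu>)
next
  fix A B :: "(nat \<Rightarrow> 'a) set" assume A [measurable]: "A \<in> sets seq_space" and B: "B \<in> sets seq_space"
  have m: "A \<inter> {p. p 0 = i} \<in> sets seq_space" for i
    by (rule measurable_Int_first) fact
  have "(\<integral>\<^sup>+p. emeasure (\<nu> (p 0)) B * indicator A p \<partial>past_law M)
      = (\<integral>\<^sup>+p. (\<Sum>i\<in>S. emeasure (\<nu> i) B * indicator (A \<inter> {p. p 0 = i}) p) \<partial>past_law M)"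
    using AE
  proof (intro nn_integral_cong_AE, eventually_elim)
    fix p :: "nat \<Rightarrow> 'a" assume "p 0 \<in> S"
    then show "emeasure (\<nu> (p 0)) B * indicator A p
        = (\<Sum>i\<in>S. emeasure (\<nu> i) B * indicator (A \<inter> {p. p 0 = i}) p)"
      using fin by (subst sum.remove[of _ "p 0"]) (auto intro!: sum.neutral simp: indicator_def)
  qed
  also have "\<dots> = (\<Sum>i\<in>S. emeasure (\<nu> i) B * emeasure (past_law M) (A \<inter> {p. p 0 = i}))"
    by (subst nn_integral_sum)
       (auto simp: m intro!: sum.cong nn_integral_cmult_indicator borel_measurable_times_ennreal
          borel_measurable_indicator)
  finally show "emeasure M {\<omega> \<in> space M. past \<omega> \<in> A \<and> future \<omega> \<in> B}
      = (\<integral>\<^sup>+p. emeasure (\<nu> (p 0)) B * indicator A p \<partial>past_law M)"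
    using eq[OF A B] by simp
qed

lemma stochastic_reverse_process:
  assumes "stochastic_process M"
  shows "stochastic_process (reverse_process M)"
proof -
  have "(\<lambda>\<omega> t. \<omega> (- (t + 1))) \<in> M \<rightarrow>\<^sub>M process_space"
    using assms by (intro measurable_into_process_space measurable_stochastic_process_component)
  then show ?thesis
    using assms unfolding stochastic_process_def reverse_process_def
    by (auto intro: prob_space.prob_space_distr)
qed

text \<open>The reflection of time swaps -1 and 0, so it exchanges \<open>past\<close> and
  \<open>future\<close> exactly, without a further shift.\<close>

lemma reverse_process_joint:
  fixes M :: "(int \<Rightarrow> 'a::countable) measure"
  assumes M: "stochastic_process M" and [measurable]: "A \<in> sets seq_space" "B \<in> sets seq_space"
  shows "emeasure (reverse_process M) {\<omega> \<in> space (reverse_process M). past \<omega> \<in> A \<and> future \<omega> \<in> B}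
    = emeasure M {\<omega> \<in> space M. past \<omega> \<in> B \<and> future \<omega> \<in> A}"
proof -
  have m: "(\<lambda>\<omega> t. \<omega> (- (t + 1))) \<in> M \<rightarrow>\<^sub>M process_space"
    using M by (intro measurable_into_process_space measurable_stochastic_process_component)
  have "{\<omega>::int \<Rightarrow> 'a. past \<omega> \<in> A \<and> future \<omega> \<in> B} = {\<omega> \<in> space process_space. past \<omega> \<in> A \<and> future \<omega> \<in> B}"
    by simp
  also have "\<dots> \<in> sets process_space" by measurable
  finally have ms: "{\<omega>::int \<Rightarrow> 'a. past \<omega> \<in> A \<and> future \<omega> \<in> B} \<in> sets process_space" .
  have e: "past (\<lambda>t. \<omega> (- t - 1)) = future \<omega>" "future (\<lambda>t. \<omega> (- t - 1)) = past \<omega>"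
    for \<omega> :: "int \<Rightarrow> 'a"
    by (auto simp: past_def future_def fun_eq_iff intro!: arg_cong[where f=\<omega>])
  have "emeasure (reverse_process M) {\<omega> \<in> space (reverse_process M). past \<omega> \<in> A \<and> future \<omega> \<in> B}
    = emeasure M ((\<lambda>\<omega> t. \<omega> (- (t + 1))) -` {\<omega>. past \<omega> \<in> A \<and> future \<omega> \<in> B} \<inter> space M)"
    using emeasure_distr[OF m ms] by (simp add: reverse_process_def)
  also have "\<dots> = emeasure M {\<omega> \<in> space M. past \<omega> \<in> B \<and> future \<omega> \<in> A}"
    by (rule arg_cong[where f="emeasure M"]) (auto simp: e)
  finally show ?thesis .
qed

lemma emeasure_prob_algebra_UNIV:
  "N \<in> space (prob_algebra seq_space) \<Longrightarrow> emeasure N UNIV = 1"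
  using prob_space.emeasure_space_1[of N]
  by (simp add: space_prob_algebra) (metis sets_eq_imp_space_eq space_seq_space)

lemma UNIV_in_sets_seq_space: "UNIV \<in> sets seq_space"
  using sets.top[of seq_space] by simp

lemma emeasure_past_law_coin_process:
  assumes "A \<in> sets seq_space"
  shows "emeasure (past_law coin_process) A
    = emeasure (past_given True) A / 2 + emeasure (past_given False) A / 2"
  using coin_process_joint[OF assms UNIV_in_sets_seq_space]
  by (simp add: emeasure_past_law[OF stochastic_coin_process assms]
      emeasure_prob_algebra_UNIV[OF future_given_in_prob_algebra])

lemma emeasure_past_law_reverse_coin_process:
  assumes "A \<in> sets seq_space"
  shows "emeasure (past_law (reverse_process coin_process)) A
    = emeasure (future_given True) A / 2 + emeasure (future_given False) A / 2"
  using reverse_process_joint[OF stochastic_coin_process assms UNIV_in_sets_seq_space]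
    coin_process_joint[OF UNIV_in_sets_seq_space assms]
  by (simp add: emeasure_past_law[OF stochastic_reverse_process[OF stochastic_coin_process] assms]
      emeasure_prob_algebra_UNIV[OF past_given_in_prob_algebra])

lemma emeasure_past_given:
  assumes "A \<in> sets seq_space"
  shows "emeasure (past_given u) A = emeasure coins {U \<in> space coins. (\<lambda>k. symbol (U k) (case_nat u U k)) \<in> A}"
  unfolding past_given_def using assms
  by (simp add: emeasure_distr[OF measurable_past_given] vimage_def Int_def conj_commute)

lemma emeasure_future_given:
  assumes "A \<in> sets seq_space"
  shows "emeasure (future_given u) A = emeasure coins {V \<in> space coins. (\<lambda>k. symbol (case_nat u V k) (V k)) \<in> A}"
  unfolding future_given_def using assms
  by (simp add: emeasure_distr[OF measurable_future_given] vimage_def Int_def conj_commute)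

text \<open>The last symbol is 2 exactly when the conditioning bit is 1. This lets the two terms of
  \<open>coin_process_joint\<close> be regrouped by the last symbol.\<close>

lemma past_given_Int_first:
  assumes A: "A \<in> sets seq_space"
  shows "emeasure (past_given True) (A \<inter> {p. p 0 = 0}) = 0"
    and "emeasure (past_given True) (A \<inter> {p. p 0 = 1}) = 0"
    and "emeasure (past_given True) (A \<inter> {p. p 0 = 2}) = emeasure (past_given True) A"
    and "emeasure (past_given False) (A \<inter> {p. p 0 = 2}) = 0"
    and "emeasure (past_given False) A = emeasure (past_given False) (A \<inter> {p. p 0 = 0})
      + emeasure (past_given False) (A \<inter> {p. p 0 = 1})"
proof -
  note e = emeasure_past_given[OF measurable_Int_first[OF A]] emeasure_past_given[OF A]
  show "emeasure (past_given True) (A \<inter> {p. p 0 = 0}) = 0"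
    "emeasure (past_given True) (A \<inter> {p. p 0 = 1}) = 0"
    "emeasure (past_given False) (A \<inter> {p. p 0 = 2}) = 0"
    "emeasure (past_given True) (A \<inter> {p. p 0 = 2}) = emeasure (past_given True) A"
    by (simp_all add: e symbol_def)
  have m: "{U \<in> space coins. (\<lambda>k. symbol (U k) (case_nat u U k)) \<in> A \<inter> {p. p 0 = i}} \<in> sets coins" for u i
    using measurable_sets[OF measurable_past_given measurable_Int_first[OF A]]
    by (simp add: vimage_def Int_def conj_ac)
  show "emeasure (past_given False) A = emeasure (past_given False) (A \<inter> {p. p 0 = 0})
      + emeasure (past_given False) (A \<inter> {p. p 0 = 1})"
    unfolding e
    by (subst plus_emeasure[OF m m]) (auto simp: symbol_def intro!: arg_cong[where f="emeasure coins"])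
qed

text \<open>The conditioning bit enters the future through the symbol at time 0 alone: a 0 or a 1
  there reveals it, a 2 erases it. Hence both laws agree on the futures starting with 2.\<close>

lemma future_given_Int_first:
  assumes A: "A \<in> sets seq_space"
  shows "emeasure (future_given True) (A \<inter> {p. p 0 = 1}) = 0"
    and "emeasure (future_given False) (A \<inter> {p. p 0 = 0}) = 0"
    and "emeasure (future_given True) (A \<inter> {p. p 0 = 2}) = emeasure (future_given False) (A \<inter> {p. p 0 = 2})"
    and "emeasure (future_given True) A = emeasure (future_given True) (A \<inter> {p. p 0 = 0})
      + emeasure (future_given True) (A \<inter> {p. p 0 = 2})"
    and "emeasure (future_given False) A = emeasure (future_given False) (A \<inter> {p. p 0 = 1})
      + emeasure (future_given False) (A \<inter> {p. p 0 = 2})"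
proof -
  note e = emeasure_future_given[OF measurable_Int_first[OF A]] emeasure_future_given[OF A]
  show "emeasure (future_given True) (A \<inter> {p. p 0 = 1}) = 0"
    "emeasure (future_given False) (A \<inter> {p. p 0 = 0}) = 0"
    by (simp_all add: e symbol_def)
  have "(\<lambda>k. symbol (case_nat True V k) (V k)) = (\<lambda>k. symbol (case_nat False V k) (V k))" if "V 0" for V
    using that by (auto simp: fun_eq_iff symbol_def split: nat.split)
  then show "emeasure (future_given True) (A \<inter> {p. p 0 = 2}) = emeasure (future_given False) (A \<inter> {p. p 0 = 2})"
    unfolding e by (intro arg_cong[where f="emeasure coins"]) (auto simp: symbol_def split: if_splits)
  have m: "{V \<in> space coins. (\<lambda>k. symbol (case_nat u V k) (V k)) \<in> A \<inter> {p. p 0 = i}} \<in> sets coins" for u i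
    using measurable_sets[OF measurable_future_given measurable_Int_first[OF A]]
    by (simp add: vimage_def Int_def conj_ac)
  show "emeasure (future_given True) A = emeasure (future_given True) (A \<inter> {p. p 0 = 0})
      + emeasure (future_given True) (A \<inter> {p. p 0 = 2})"
    unfolding e
    by (subst plus_emeasure[OF m m]) (auto simp: symbol_def intro!: arg_cong[where f="emeasure coins"])
  show "emeasure (future_given False) A = emeasure (future_given False) (A \<inter> {p. p 0 = 1})
      + emeasure (future_given False) (A \<inter> {p. p 0 = 2})"
    unfolding e
    by (subst plus_emeasure[OF m m]) (auto simp: symbol_def intro!: arg_cong[where f="emeasure coins"])
qed


section \<open>Conditional laws and transition matrices in the two time directions\<close>

definition next_given :: "nat \<Rightarrow> (nat \<Rightarrow> nat) measure" where
  "next_given i = future_given (i = 2)"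

text \<open>In reverse time the conditioning symbol sits at time 0 of the original process. A 2
  there says nothing about the bit at time -1, which leaves the unconditional law of the
  past.\<close>

definition previous_given :: "nat \<Rightarrow> (nat \<Rightarrow> nat) measure" where
  "previous_given i = (if i = 0 then past_given True else if i = 1 then past_given False
     else past_law coin_process)"

definition frequency :: "nat \<Rightarrow> real" where
  "frequency i = (if i = 2 then 1/2 else if i < 2 then 1/4 else 0)"

definition forward_trans :: "nat \<Rightarrow> nat \<Rightarrow> real" where
  "forward_trans i x = (if x = 2 \<or> x = (if i = 2 then 0 else 1) then 1/2 else 0)"

text \<open>Row \<open>i\<close> is the law of the symbol preceding an \<open>i\<close>: a 0 says
  that the preceding bit is 1 and so the preceding symbol 2, a 1 says that this bit is 0 and so
  leaves 0 and 1 equally likely, a 2 says nothing.\<close>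

definition backward_trans :: "nat \<Rightarrow> nat \<Rightarrow> real" where
  "backward_trans i x = (if i = 0 then (if x = 2 then 1 else 0)
     else if i = 1 then (if x < 2 then 1/2 else 0) else frequency x)"

lemma emeasure_coins_first:
  "emeasure coins {U \<in> space coins. U 0 \<in> S} = ennreal (measure coin S)"
proof -
  have "emeasure (distr coins coin (\<lambda>U. U 0)) S = ennreal (measure coin S)"
    by (subst distr_PiM_component) (simp_all add: measure_pmf.prob_space_axioms measure_pmf.emeasure_eq_measure)
  then show ?thesis
    by (subst (asm) emeasure_distr) (simp_all add: vimage_def Int_def conj_commute measurable_component_singleton)
qed

lemma measure_coin: "measure coin S = (if True \<in> S then 1/2 else 0) + (if False \<in> S then 1/2 else 0)"
proof -
  have "measure coin S = (\<Sum>b\<in>S. pmf (bernoulli_pmf (1/2)) b)"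
    by (rule measure_measure_pmf_finite) simp
  also have "\<dots> = (\<Sum>b\<in>UNIV. if b \<in> S then pmf (bernoulli_pmf (1/2)) b else 0)"
    by (rule sum.mono_neutral_cong_left) auto
  finally show ?thesis by (simp add: UNIV_bool)
qed

lemma sets_first [measurable]: "{p::nat \<Rightarrow> 'a::countable. p 0 = x} \<in> sets seq_space"
proof -
  have "{p::nat \<Rightarrow> 'a \<in> space seq_space. p 0 = x} \<in> sets seq_space" by measurable
  then show ?thesis by simp
qed

lemma future_given_first:
  "emeasure (future_given u) {p. p 0 = x} = ennreal (forward_trans (if u then 2 else 0) x)"
proof -
  have "emeasure (future_given u) {p. p 0 = x} = emeasure coins {V \<in> space coins. V 0 \<in> {b. symbol u b = x}}"
    by (simp add: emeasure_future_given)
  moreover have "measure coin {b. symbol u b = x} = forward_trans (if u then 2 else 0) x"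
    by (auto simp: measure_coin symbol_def forward_trans_def)
  ultimately show ?thesis
    by (simp only: emeasure_coins_first)
qed

lemma past_given_first:
  "emeasure (past_given u) {p. p 0 = x} = ennreal (backward_trans (if u then 0 else 1) x)"
proof -
  have "emeasure (past_given u) {p. p 0 = x} = emeasure coins {V \<in> space coins. V 0 \<in> {b. symbol b u = x}}"
    by (simp add: emeasure_past_given)
  moreover have "measure coin {b. symbol b u = x} = backward_trans (if u then 0 else 1) x"
    by (auto simp: measure_coin symbol_def backward_trans_def)
  ultimately show ?thesis
    by (simp only: emeasure_coins_first)
qed

lemma ennreal_half: "ennreal r / 2 = ennreal (r / 2)"
  by (cases "0 \<le> r") (auto simp: ennreal_divide_numeral ennreal_neg)

lemma past_law_coin_process_first:
  "emeasure (past_law coin_process) {p. p 0 = x} = ennreal (frequency x)"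
  by (auto simp: emeasure_past_law_coin_process past_given_first backward_trans_def frequency_def
     ennreal_half simp flip: ennreal_plus)

lemma past_law_reverse_coin_process_first:
  "emeasure (past_law (reverse_process coin_process)) {p. p 0 = x} = ennreal (frequency x)"
  by (auto simp: emeasure_past_law_reverse_coin_process future_given_first forward_trans_def frequency_def
     ennreal_half simp flip: ennreal_plus)

lemma AE_frequency:
  assumes f: "\<And>x. emeasure (past_law M) {p. p 0 = x} = ennreal (frequency x)"
  shows "AE p in past_law M. p 0 < 3"
proof -
  have "AE p in past_law M. p 0 \<noteq> x" if "\<not> x < 3" for x
    using that by (intro AE_I[of _ _ "{p. p 0 = x}"]) (auto simp: f frequency_def sets_first)
  then have "AE p in past_law M. \<forall>x. \<not> x < 3 \<longrightarrow> p 0 \<noteq> x"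
    by (auto simp: AE_all_countable)
  then show ?thesis by eventually_elim blast
qed

lemma past_law_coin_process_in_prob_algebra: "past_law coin_process \<in> space (prob_algebra seq_space)"
  by (simp add: space_prob_algebra prob_space_past_law stochastic_coin_process)

lemma next_given_first: "measure (next_given i) {y. y 0 = x} = forward_trans i x"
  by (auto simp: next_given_def measure_def future_given_first forward_trans_def)

lemma previous_given_first: "measure (previous_given i) {y. y 0 = x} = backward_trans i x"
  by (auto simp: previous_given_def measure_def past_given_first past_law_coin_process_first
     backward_trans_def frequency_def)

lemma lessThan_3: "{..<3::nat} = {0, 1, 2}"
  by auto

lemma ennreal_half_add: "(x::ennreal) / 2 + x / 2 = x"
  by (cases x) (auto simp: ennreal_half simp flip: ennreal_plus, simp add: ennreal_top_divide)

lemma regular_cond_future_coin_process: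
  "regular_cond_future coin_process (\<lambda>p. next_given (p 0))"
proof (rule regular_cond_futureI[OF stochastic_coin_process, of "{..<3}"])
  show "AE p in past_law coin_process. p 0 \<in> {..<3}"
    using AE_frequency[OF past_law_coin_process_first] by simp
  fix A B :: "(nat \<Rightarrow> nat) set" assume A: "A \<in> sets seq_space" and B: "B \<in> sets seq_space"
  show "emeasure coin_process {\<omega> \<in> space coin_process. past \<omega> \<in> A \<and> future \<omega> \<in> B}
     = (\<Sum>i<3. emeasure (next_given i) B * emeasure (past_law coin_process) (A \<inter> {p. p 0 = i}))"
    unfolding coin_process_joint[OF A B] lessThan_3 past_given_Int_first(5)[OF A]
    using past_given_Int_first(1-4)[OF A]
    by (simp add: next_given_def emeasure_past_law_coin_process measurable_Int_first A
       divide_ennreal_def algebra_simps)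
qed (simp_all add: next_given_def future_given_in_prob_algebra)

text \<open>On the event that the conditioning symbol is 2, both bits carry the same weight, by the
  third part of \<open>future_given_Int_first\<close>. Their two past laws therefore average to
  \<open>past_law coin_process\<close>.\<close>

lemma regular_cond_future_reverse_coin_process:
  "regular_cond_future (reverse_process coin_process) (\<lambda>p. previous_given (p 0))"
proof (rule regular_cond_futureI[OF stochastic_reverse_process[OF stochastic_coin_process], of "{..<3}"])
  show "AE p in past_law (reverse_process coin_process). p 0 \<in> {..<3}"
    using AE_frequency[OF past_law_reverse_coin_process_first] by simp
  fix A B :: "(nat \<Rightarrow> nat) set" assume A: "A \<in> sets seq_space" and B: "B \<in> sets seq_space"
  let ?g = "emeasure (future_given False) (A \<inter> {p. p 0 = 2})"
  have "(\<Sum>i<3. emeasure (previous_given i) B * emeasure (past_law (reverse_process coin_process)) (A \<inter> {p. p 0 = i}))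
    = emeasure (past_given True) B * (emeasure (future_given True) (A \<inter> {p. p 0 = 0}) / 2)
      + emeasure (past_given False) B * (emeasure (future_given False) (A \<inter> {p. p 0 = 1}) / 2)
      + (emeasure (past_given True) B / 2 + emeasure (past_given False) B / 2) * ?g"
    unfolding lessThan_3 using future_given_Int_first(1-3)[OF A]
    by (simp add: previous_given_def emeasure_past_law_coin_process[OF B] ennreal_half_add
        emeasure_past_law_reverse_coin_process measurable_Int_first A add_ac)
  also have "\<dots> = emeasure coin_process {\<omega> \<in> space coin_process. past \<omega> \<in> B \<and> future \<omega> \<in> A}"
    unfolding coin_process_joint[OF B A] future_given_Int_first(4-5)[OF A] future_given_Int_first(3)[OF A]
    by (simp add: divide_ennreal_def algebra_simps)
  finally show "emeasure (reverse_process coin_process)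
       {\<omega> \<in> space (reverse_process coin_process). past \<omega> \<in> A \<and> future \<omega> \<in> B}
     = (\<Sum>i<3. emeasure (previous_given i) B
         * emeasure (past_law (reverse_process coin_process)) (A \<inter> {p. p 0 = i}))"
    by (simp add: reverse_process_joint[OF stochastic_coin_process A B])
qed (simp_all add: previous_given_def past_given_in_prob_algebra past_law_coin_process_in_prob_algebra)

section \<open>Causal states of Markov chains\<close>

definition cylinder :: "'a list \<Rightarrow> (nat \<Rightarrow> 'a) set" where
  "cylinder w = {y. \<forall>i<length w. y i = w ! i}"

text \<open>Two cylinders are nested if one word is a prefix of the other and disjoint otherwise;
  the empty set is added for the second case.\<close>

lemma Int_stable_cylinders: "Int_stable (insert {} (range cylinder))"
proof -
  have "cylinder v \<inter> cylinder w \<in> insert {} (range cylinder)" if "length v \<le> length w" for v w :: "'a list"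
  proof (cases "v = take (length v) w")
    case True
    have "v ! i = w ! i" if "i < length v" for i
      using nth_take[OF that, of w] True by simp
    then have "cylinder w \<subseteq> cylinder v"
      using that unfolding cylinder_def by fastforce
    then have "cylinder v \<inter> cylinder w = cylinder w" by blast
    then show ?thesis by simp
  next
    case False
    have "\<not> (\<forall>i<length v. v ! i = w ! i)"
    proof
      assume "\<forall>i<length v. v ! i = w ! i"
      then have "v = take (length v) w"
        by (intro nth_equalityI) (simp_all add: that min_absorb2)
      with False show False ..
    qed
    then obtain i where i: "i < length v" "v ! i \<noteq> w ! i" by blast
    have "y \<notin> cylinder w" if "y \<in> cylinder v" for y
      using i that \<open>length v \<le> length w\<close> unfolding cylinder_def
      by (auto intro!: exI[of _ i])
    then have "cylinder v \<inter> cylinder w = {}" by blast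
    then show ?thesis by simp
  qed
  then have "cylinder v \<inter> cylinder w \<in> insert {} (range cylinder)" for v w :: "'a list"
    using linear[of "length v" "length w"] Int_commute[of "cylinder v" "cylinder w"] by metis
  then show ?thesis
    unfolding Int_stable_def by blast
qed

lemma cylinder_in_sets: "cylinder w \<in> sets seq_space"
proof -
  have "{y \<in> space seq_space. \<forall>i<length w. y i = w ! i} \<in> sets seq_space" by measurable
  then show ?thesis by (simp add: cylinder_def)
qed

text \<open>An event about the coordinate \<open>i\<close> is a union of cylinders over words of
  length \<open>Suc i\<close>, and there are only countably many such words.\<close>

lemma sets_seq_space_cylinders:
  "sets (seq_space :: (nat \<Rightarrow> 'a::countable) measure) = sigma_sets UNIV (insert {} (range cylinder))"
    (is "_ = sigma_sets UNIV ?G")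
proof -
  have "{f::nat \<Rightarrow> 'a. f i \<in> A} \<in> sigma_sets UNIV ?G" for i A
  proof -
    have "{f::nat \<Rightarrow> 'a. f i \<in> A} = (\<Union>w\<in>{w. length w = Suc i \<and> w ! i \<in> A}. cylinder w)"
    proof (intro set_eqI iffI)
      fix f :: "nat \<Rightarrow> 'a" assume "f \<in> {f. f i \<in> A}"
      then show "f \<in> (\<Union>w\<in>{w. length w = Suc i \<and> w ! i \<in> A}. cylinder w)"
        by (intro UN_I[of "map f [0..<Suc i]"]) (auto simp: cylinder_def nth_append less_Suc_eq simp del: upt_Suc)
    qed (auto simp: cylinder_def)
    also have "\<dots> \<in> sigma_sets UNIV ?G"
      by (rule sigma_sets_UNION) auto
    finally show ?thesis .
  qed
  moreover have "b \<in> sets seq_space" if "b \<in> ?G" for b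
    using that by (auto simp: cylinder_in_sets)
  ultimately show ?thesis
    unfolding seq_space_def sets_PiM_single space_count_space PiE_UNIV_domain Pi_UNIV
    by (intro sigma_sets_eqI) auto
qed

lemma measure_eqI_cylinders:
  assumes "sets N = sets seq_space" "sets N' = sets seq_space" "emeasure N UNIV \<noteq> \<infinity>"
    and "\<And>w. emeasure N (cylinder w) = emeasure N' (cylinder w)"
  shows "N = N'"
proof (rule measure_eqI_generator_eq[OF Int_stable_cylinders, of UNIV])
  show "range (\<lambda>_::nat. cylinder []) \<subseteq> insert {} (range cylinder)" by auto
qed (use assms in \<open>auto simp: sets_seq_space_cylinders cylinder_def\<close>)

text \<open>On a fixed cylinder, both kernels are densities of one and the same finite measure,
  hence equal almost surely. As there are countably many cylinders, the exceptional null sets can be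
  united, and cylinders determine a probability measure.\<close>

lemma regular_cond_future_unique:
  assumes M: "stochastic_process M"
    and \<kappa>: "regular_cond_future M \<kappa>" and \<kappa>': "regular_cond_future M \<kappa>'"
  shows "AE p in past_law M. \<kappa> p = \<kappa>' p"
proof -
  interpret P: prob_space "past_law M" by (rule prob_space_past_law[OF M])
  have k: "\<kappa> p \<in> space (prob_algebra seq_space)" "\<kappa>' p \<in> space (prob_algebra seq_space)" for p
    using \<kappa> \<kappa>' unfolding regular_cond_future_def by (auto dest!: measurable_space)
  have "AE p in past_law M. emeasure (\<kappa> p) (cylinder w) = emeasure (\<kappa>' p) (cylinder w)" for w
  proof -
    let ?f = "\<lambda>p. emeasure (\<kappa> p) (cylinder w)" and ?g = "\<lambda>p. emeasure (\<kappa>' p) (cylinder w)"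
    have m: "?f \<in> borel_measurable (past_law M)" "?g \<in> borel_measurable (past_law M)"
      using \<kappa> \<kappa>' cylinder_in_sets[of w] unfolding regular_cond_future_def
      by (auto intro!: measurable_compose[OF measurable_prob_algebraD measurable_emeasure_subprob_algebra]
          simp: measurable_cong_sets[OF sets_past_law refl])
    have le: "?f p \<le> 1" for p
      using k(1)[of p] by (auto simp: space_prob_algebra intro: prob_space.emeasure_le_1)
    have "integral\<^sup>N (past_law M) ?f \<le> (\<integral>\<^sup>+p. 1 \<partial>past_law M)"
      by (intro nn_integral_mono le)
    then have fin: "integral\<^sup>N (past_law M) ?f \<noteq> \<infinity>"
      by (auto simp: P.emeasure_space_1 top_unique)
    have "density (past_law M) ?f = density (past_law M) ?g"
    proof (rule measure_eqI)
      fix A assume "A \<in> sets (density (past_law M) ?f)"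
      then have "A \<in> sets seq_space" by simp
      then show "emeasure (density (past_law M) ?f) A = emeasure (density (past_law M) ?g) A"
        using \<kappa> \<kappa>' cylinder_in_sets[of w] m
        unfolding regular_cond_future_def by (simp add: emeasure_density)
    qed simp
    then show ?thesis
      using finite_density_unique[OF m _ _ fin] by simp
  qed
  then have "AE p in past_law M. \<forall>w. emeasure (\<kappa> p) (cylinder w) = emeasure (\<kappa>' p) (cylinder w)"
    by (simp add: AE_all_countable)
  then show ?thesis
  proof eventually_elim
    case (elim p)
    then show ?case
      using k[of p] emeasure_prob_algebra_UNIV[of "\<kappa> p"]
      by (intro measure_eqI_cylinders) (auto simp: space_prob_algebra)
  qed
qed

text \<open>Equality with a probability measure \<open>N\<close> amounts to countably many
  equalities on cylinders. This is what makes causal states measurable.\<close>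

lemma sets_kernel_fibre:
  assumes \<kappa>: "\<kappa> \<in> seq_space \<rightarrow>\<^sub>M prob_algebra seq_space"
  shows "{p. \<kappa> p = N} \<in> sets seq_space"
proof (cases "N \<in> space (prob_algebra seq_space)")
  case True
  have k: "\<kappa> p \<in> space (prob_algebra seq_space)" for p
    using measurable_space[OF \<kappa>] by simp
  have [measurable]: "(\<lambda>p. emeasure (\<kappa> p) (cylinder w)) \<in> borel_measurable seq_space" for w
    using \<kappa> cylinder_in_sets[of w]
    by (auto intro!: measurable_compose[OF measurable_prob_algebraD measurable_emeasure_subprob_algebra])
  have "{p. \<kappa> p = N} = {p \<in> space seq_space. \<forall>w. emeasure (\<kappa> p) (cylinder w) = emeasure N (cylinder w)}"
    using True k emeasure_prob_algebra_UNIV[of "\<kappa> _"]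
    by (auto intro!: measure_eqI_cylinders simp: space_prob_algebra)
  also have "\<dots> \<in> sets seq_space" by measurable
  finally show ?thesis .
next
  case False
  then have "{p. \<kappa> p = N} = {}"
    using measurable_space[OF \<kappa>] by auto
  then show ?thesis by simp
qed

text \<open>A common setting for both time directions. The index 0 of a past is its most recent
  symbol, so \<open>\<nu> i\<close> is the law of the future after an \<open>i\<close>. The rows of
  \<open>T\<close> sum to one for every natural number \<open>i\<close>, also beyond the alphabet,
  so that a unit vector can be assigned to every past.\<close>

locale first_symbol_markov =
  fixes M :: "(int \<Rightarrow> nat) measure" and \<nu> :: "nat \<Rightarrow> (nat \<Rightarrow> nat) measure"
    and T :: "nat \<Rightarrow> nat \<Rightarrow> real" and \<pi> :: "nat \<Rightarrow> real" and n :: nat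
  assumes stochastic: "stochastic_process M"
    and regular: "regular_cond_future M (\<lambda>p. \<nu> (p 0))"
    and next_symbol: "\<And>i x. measure (\<nu> i) {y. y 0 = x} = T i x"
    and first_symbol: "\<And>i. emeasure (past_law M) {p. p 0 = i} = ennreal (\<pi> i)"
    and \<pi>_pos: "\<And>i. i < n \<Longrightarrow> 0 < \<pi> i"
    and AE_first: "AE p in past_law M. p 0 < n"
    and T_sum: "\<And>i. (\<Sum>x<n. T i x) = 1"
    and T_support: "\<And>i x. n \<le> x \<Longrightarrow> T i x = 0"
begin

sublocale past: prob_space "past_law M"
  by (rule prob_space_past_law[OF stochastic])

lemma regular_cond_future: "regular_cond_future M (cond_future M)"
  unfolding cond_future_def using someI[of "regular_cond_future M", OF regular] .

lemma AE_cond_future: "AE p in past_law M. cond_future M p = \<nu> (p 0)"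
  by (rule regular_cond_future_unique[OF stochastic regular_cond_future regular])

lemma AE_cond_next: "AE p in past_law M. \<forall>x. cond_next M p x = T (p 0) x"
proof -
  have sp: "space (cond_future M p) = UNIV" for p
    using regular_cond_future measurable_space[of "cond_future M" seq_space "prob_algebra seq_space" p]
    by (auto simp: regular_cond_future_def space_prob_algebra dest: sets_eq_imp_space_eq)
  show ?thesis
  proof (rule AE_mp[OF AE_cond_future], intro AE_I2 impI allI)
    fix p x assume "cond_future M p = \<nu> (p 0)"
    then show "cond_next M p x = T (p 0) x"
      using sp[of p] by (simp add: cond_next_def next_symbol[symmetric])
  qed
qed

text \<open>Up to a null set, the class of \<open>N\<close> consists of the pasts whose last symbol
  \<open>i\<close> satisfies \<open>\<nu> i = N\<close>. For an \<open>N\<close> attained only on a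
  null set, both sides vanish.\<close>

lemma measure_causal_state:
  "measure (past_law M) {q. cond_future M q = N} = sum \<pi> {i. i < n \<and> \<nu> i = N}"
proof -
  have "measure (past_law M) {q. cond_future M q = N}
      = measure (past_law M) (\<Union>i\<in>{i. i < n \<and> \<nu> i = N}. {q. q 0 = i})"
  proof (rule measure_eq_AE)
    show "AE p in past_law M. p \<in> {q. cond_future M q = N}
        \<longleftrightarrow> p \<in> (\<Union>i\<in>{i. i < n \<and> \<nu> i = N}. {q. q 0 = i})"
      using AE_cond_future AE_first by eventually_elim auto
    show "{q. cond_future M q = N} \<in> sets (past_law M)"
      using regular_cond_future sets_kernel_fibre by (auto simp: regular_cond_future_def)
  qed (auto simp: sets_first)
  also have "\<dots> = (\<Sum>i\<in>{i. i < n \<and> \<nu> i = N}. measure (past_law M) {q. q 0 = i})"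
    by (rule past.finite_measure_finite_Union) (auto simp: sets_first disjoint_family_on_def)
  also have "\<dots> = sum \<pi> {i. i < n \<and> \<nu> i = N}"
    using \<pi>_pos by (intro sum.cong) (auto simp: measure_def first_symbol less_imp_le)
  finally show ?thesis .
qed

lemma causal_states_eq: "causal_states M = (\<lambda>N. {q. cond_future M q = N}) ` range (cond_future M)"
proof -
  have "{(p, q). cond_future M p = cond_future M q} `` {p} = {q. cond_future M q = cond_future M p}" for p
    by auto
  then show ?thesis
    by (auto simp: causal_states_def quotient_def image_image)
qed

lemma sum_\<pi>_pos: "i < n \<Longrightarrow> 0 < sum \<pi> {j. j < n \<and> \<nu> j = \<nu> i}"
  by (rule sum_pos) (auto simp: \<pi>_pos)

text \<open>A set of positive probability is inhabited. The argument has to be probabilistic, since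
  \<open>cond_future\<close> is known only almost everywhere.\<close>

lemma typical_causal_state_nonempty:
  assumes "i < n"
  shows "{q. cond_future M q = \<nu> i} \<noteq> {}"
proof
  assume "{q. cond_future M q = \<nu> i} = {}"
  then have "sum \<pi> {j. j < n \<and> \<nu> j = \<nu> i} = 0"
    using measure_causal_state[of "\<nu> i"] by simp
  then show False using sum_\<pi>_pos[OF assms] by simp
qed

lemma typical_causal_states: "(\<lambda>i. {q. cond_future M q = \<nu> i}) ` {..<n} \<subseteq> causal_states M"
proof (rule image_subsetI)
  fix i assume "i \<in> {..<n}"
  then obtain q where q: "cond_future M q = \<nu> i"
    using typical_causal_state_nonempty[of i] by blast
  show "{q. cond_future M q = \<nu> i} \<in> causal_states M"
    unfolding causal_states_eq q[symmetric] by (rule imageI) (rule rangeI)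
qed

lemma countably_many_causal_states: "countably_many_causal_states M"
  unfolding countably_many_causal_states_def
proof (intro exI[of _ "(\<lambda>i. {q. cond_future M q = \<nu> i}) ` {..<n}"] conjI)
  show "AE p in past_law M. p \<in> \<Union>((\<lambda>i. {q. cond_future M q = \<nu> i}) ` {..<n})"
    using AE_cond_future AE_first by eventually_elim auto
  show "countable ((\<lambda>i. {q. cond_future M q = \<nu> i}) ` {..<n})"
    by (intro countable_finite finite_imageI finite_lessThan)
qed (rule typical_causal_states)

text \<open>The values of \<open>cond_future\<close> on a null set may add arbitrarily many further
  classes to \<open>causal_states M\<close>; they have measure zero, and \<open>entropy_term\<close>
  vanishes at 0.\<close>

lemma statistical_complexity_eq:
  "statistical_complexity M = (\<Sum>N\<in>\<nu> ` {..<n}. entropy_term (sum \<pi> {i. i < n \<and> \<nu> i = N}))"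
proof -
  let ?C = "\<lambda>N. {q. cond_future M q = N}"
  have inj: "inj_on ?C (\<nu> ` {..<n})"
  proof (rule inj_onI)
    fix N N' assume "N \<in> \<nu> ` {..<n}" and eq: "?C N = ?C N'"
    then have "?C N \<noteq> {}"
      using typical_causal_state_nonempty by blast
    with eq show "N = N'" by auto
  qed
  have "statistical_complexity M
      = (\<Sum>s\<in>?C ` \<nu> ` {..<n}. entropy_term (measure (past_law M) s))"
    unfolding statistical_complexity_def
  proof (rule nn_integral_count_space')
    fix s assume "s \<in> causal_states M" and s: "s \<notin> ?C ` \<nu> ` {..<n}"
    then obtain N where N: "s = ?C N"
      unfolding causal_states_eq by blast
    with s have "{i. i < n \<and> \<nu> i = N} = {}" by blast
    then have "measure (past_law M) s = 0"
      using measure_causal_state[of N] N by (simp only: sum.empty)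
    then show "entropy_term (measure (past_law M) s) = 0"
      by (simp add: entropy_term_def)
  qed (use typical_causal_states in \<open>simp_all only: image_image finite_imageI finite_lessThan\<close>)
  also have "\<dots> = (\<Sum>N\<in>\<nu> ` {..<n}. entropy_term (sum \<pi> {i. i < n \<and> \<nu> i = N}))"
    by (subst sum.reindex[OF inj]) (simp add: measure_causal_state)
  finally show ?thesis .
qed

end

section \<open>Instruments acting on linear combinations of memory states\<close>

lemma L2_set_sum_le:
  assumes "finite S"
  shows "L2_set (\<lambda>j. \<Sum>i\<in>S. g i j) F \<le> (\<Sum>i\<in>S. L2_set (g i) F)"
  using assms
proof (induction S rule: finite_induct)
  case empty
  then show ?case by (simp add: L2_set_def)
next
  case (insert i S)
  then show ?case
    using L2_set_triangle_ineq[of "g i" "\<lambda>j. \<Sum>i\<in>S. g i j" F] by simp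
qed

text \<open>Minkowski's inequality for the vectors \<open>g i\<close>, in squared form because
  outcome probabilities are squared norms.\<close>

lemma sum_power2_sum_le:
  fixes g :: "'i \<Rightarrow> 'j \<Rightarrow> real"
  assumes S: "finite S" and b: "\<And>i. i \<in> S \<Longrightarrow> 0 \<le> b i"
    and g: "\<And>i. i \<in> S \<Longrightarrow> (\<Sum>j\<in>F. (g i j)\<^sup>2) \<le> (b i)\<^sup>2"
  shows "(\<Sum>j\<in>F. (\<Sum>i\<in>S. g i j)\<^sup>2) \<le> (\<Sum>i\<in>S. b i)\<^sup>2"
proof -
  have "L2_set (\<lambda>j. \<Sum>i\<in>S. g i j) F \<le> (\<Sum>i\<in>S. L2_set (g i) F)"
    by (rule L2_set_sum_le[OF S])
  also have "\<dots> \<le> (\<Sum>i\<in>S. b i)"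
    using b g unfolding L2_set_def by (intro sum_mono real_le_lsqrt) auto
  finally have "(L2_set (\<lambda>j. \<Sum>i\<in>S. g i j) F)\<^sup>2 \<le> (\<Sum>i\<in>S. b i)\<^sup>2"
    by (intro power_mono) (auto simp: L2_set_def sum_nonneg)
  then show ?thesis
    by (simp add: L2_set_def sum_nonneg)
qed

section \<open>Linear combinations of square-summable sequences\<close>

lemma ell2_norm_sq_nonneg [simp]: "0 \<le> ell2_norm_sq \<psi>"
  unfolding ell2_norm_sq_def by (rule infsum_nonneg) simp

lemma sum_le_ell2_norm_sq:
  assumes "\<psi> \<in> ell2 I" "finite F"
  shows "(\<Sum>a\<in>F. (cmod (\<psi> a))\<^sup>2) \<le> ell2_norm_sq \<psi>"
  using assms unfolding ell2_norm_sq_def ell2_def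
  by (intro finite_sum_le_infsum) auto

text \<open>Minkowski's inequality bounds all finite partial sums uniformly, which yields
  summability and the norm estimate together.\<close>

lemma
  assumes S: "finite S" and \<psi>: "\<And>i. i \<in> S \<Longrightarrow> \<psi> i \<in> ell2 I"
  shows ell2_linear_combination: "(\<lambda>a. \<Sum>i\<in>S. c i * \<psi> i a) \<in> ell2 I" (is "?w \<in> _")
    and ell2_norm_sq_linear_combination:
      "ell2_norm_sq (\<lambda>a. \<Sum>i\<in>S. c i * \<psi> i a) \<le> (\<Sum>i\<in>S. cmod (c i) * sqrt (ell2_norm_sq (\<psi> i)))\<^sup>2"
proof -
  have fin: "(\<Sum>a\<in>F. (cmod (?w a))\<^sup>2) \<le> (\<Sum>i\<in>S. cmod (c i) * sqrt (ell2_norm_sq (\<psi> i)))\<^sup>2"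
    if F: "finite F" for F
  proof -
    have "cmod (?w a) \<le> (\<Sum>i\<in>S. cmod (c i) * cmod (\<psi> i a))" for a
      by (rule order_trans[OF norm_sum]) (simp add: norm_mult)
    then have "(\<Sum>a\<in>F. (cmod (?w a))\<^sup>2) \<le> (\<Sum>a\<in>F. (\<Sum>i\<in>S. cmod (c i) * cmod (\<psi> i a))\<^sup>2)"
      by (intro sum_mono power_mono) auto
    also have "\<dots> \<le> (\<Sum>i\<in>S. cmod (c i) * sqrt (ell2_norm_sq (\<psi> i)))\<^sup>2"
      using sum_le_ell2_norm_sq[OF \<psi> F]
      by (intro sum_power2_sum_le S)
        (auto simp: power_mult_distrib simp flip: sum_distrib_left intro!: mult_left_mono)
    finally show ?thesis .
  qed
  have "(\<lambda>a. (cmod (?w a))\<^sup>2) summable_on UNIV"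
    by (rule nonneg_bdd_above_summable_on) (auto intro!: bdd_aboveI2 fin)
  then show "?w \<in> ell2 I"
    using \<psi> by (auto simp: ell2_def)
  then show "ell2_norm_sq ?w \<le> (\<Sum>i\<in>S. cmod (c i) * sqrt (ell2_norm_sq (\<psi> i)))\<^sup>2"
    unfolding ell2_norm_sq_def[of ?w] by (intro infsum_le_finite_sums fin) (auto simp: ell2_def)
qed

lemma ell2_operator_add:
  "ell2_operator I T \<Longrightarrow> \<phi> \<in> ell2 I \<Longrightarrow> \<psi> \<in> ell2 I \<Longrightarrow> T (\<lambda>i. \<phi> i + \<psi> i) = (\<lambda>i. T \<phi> i + T \<psi> i)"
  by (simp add: ell2_operator_def)

lemma ell2_operator_scale:
  "ell2_operator I T \<Longrightarrow> \<psi> \<in> ell2 I \<Longrightarrow> T (\<lambda>i. c * \<psi> i) = (\<lambda>i. c * T \<psi> i)"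
  by (simp add: ell2_operator_def)

lemma ell2_operator_linear_combination:
  assumes T: "ell2_operator I T" and "finite S" and \<psi>: "\<And>i. i \<in> S \<Longrightarrow> \<psi> i \<in> ell2 I"
  shows "T (\<lambda>a. \<Sum>i\<in>S. c i * \<psi> i a) = (\<lambda>a. \<Sum>i\<in>S. c i * T (\<psi> i) a)"
  using assms(2) \<psi>
proof (induction S rule: finite_induct)
  case empty
  have "(\<lambda>_. 0) \<in> ell2 I" by (simp add: ell2_def)
  then show ?case
    using ell2_operator_scale[OF T, of "\<lambda>_. 0" 0] by simp
next
  case (insert i S)
  have 1: "(\<lambda>a. \<Sum>i\<in>S. c i * \<psi> i a) \<in> ell2 I"
    using insert by (intro ell2_linear_combination) auto
  have 2: "(\<lambda>a. c i * \<psi> i a) \<in> ell2 I"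
    using ell2_linear_combination[of "{i}" \<psi> I c] insert.prems by simp
  have "T (\<lambda>a. c i * \<psi> i a + (\<Sum>i\<in>S. c i * \<psi> i a)) = (\<lambda>a. T (\<lambda>a. c i * \<psi> i a) a + T (\<lambda>a. \<Sum>i\<in>S. c i * \<psi> i a) a)"
    by (rule ell2_operator_add[OF T 2 1])
  also have "T (\<lambda>a. c i * \<psi> i a) = (\<lambda>a. c i * T (\<psi> i) a)"
    by (rule ell2_operator_scale[OF T]) (simp add: insert.prems)
  finally show ?case
    using insert by simp
qed

text \<open>The instrument preserves the total squared norm, which therefore splits over the
  outcomes. For one outcome \<open>x\<close>, Minkowski over the Kraus index replaces the unknown
  overlaps of the branches by the worst case of full alignment, so that only the probabilities
  \<open>t i x\<close> remain.\<close>

lemma instrument_norm_sq_linear_combination: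
  fixes K :: "'x \<Rightarrow> nat \<Rightarrow> (nat \<Rightarrow> complex) \<Rightarrow> nat \<Rightarrow> complex"
  assumes K: "quantum_instrument I K" and S: "finite S"
    and \<psi>: "\<And>i. i \<in> S \<Longrightarrow> \<psi> i \<in> ell2 I"
    and t: "\<And>i x. i \<in> S \<Longrightarrow> ((\<lambda>j. ell2_norm_sq (K x j (\<psi> i))) has_sum t i x) UNIV"
    and X: "finite X" "\<And>i x. i \<in> S \<Longrightarrow> x \<notin> X \<Longrightarrow> t i x = 0"
  shows "ell2_norm_sq (\<lambda>a. \<Sum>i\<in>S. c i * \<psi> i a) \<le> (\<Sum>x\<in>X. (\<Sum>i\<in>S. cmod (c i) * sqrt (t i x))\<^sup>2)"
proof -
  let ?w = "\<lambda>a. \<Sum>i\<in>S. c i * \<psi> i a"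
  let ?R = "\<lambda>x. (\<Sum>i\<in>S. cmod (c i) * sqrt (t i x))\<^sup>2"
  have op: "ell2_operator I (K x j)" for x j
    using K by (simp add: quantum_instrument_def)
  have K\<psi>: "K x j (\<psi> i) \<in> ell2 I" if "i \<in> S" for x j i
    using op[of x j] \<psi>[OF that] by (simp add: ell2_operator_def)
  have w: "?w \<in> ell2 I" by (rule ell2_linear_combination[OF S \<psi>])
  have t0: "0 \<le> t i x" if "i \<in> S" for i x
    using t[OF that] by (rule has_sum_nonneg) simp
  have outcome: "(\<Sum>j\<in>G. ell2_norm_sq (K x j ?w)) \<le> ?R x" if G: "finite G" for x G
  proof -
    have "(\<Sum>j\<in>G. ell2_norm_sq (K x j ?w))
        \<le> (\<Sum>j\<in>G. (\<Sum>i\<in>S. cmod (c i) * sqrt (ell2_norm_sq (K x j (\<psi> i))))\<^sup>2)"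
      using ell2_norm_sq_linear_combination[OF S K\<psi>]
      by (simp add: ell2_operator_linear_combination[OF op S \<psi>] sum_mono)
    also have "\<dots> \<le> ?R x"
    proof (rule sum_power2_sum_le[OF S])
      fix i assume i: "i \<in> S"
      show "0 \<le> cmod (c i) * sqrt (t i x)" using t0[OF i] by simp
      have "(\<Sum>j\<in>G. ell2_norm_sq (K x j (\<psi> i))) \<le> t i x"
        using finite_sum_le_has_sum[OF t[OF i] G] by simp
      then show "(\<Sum>j\<in>G. (cmod (c i) * sqrt (ell2_norm_sq (K x j (\<psi> i))))\<^sup>2) \<le> (cmod (c i) * sqrt (t i x))\<^sup>2"
        using t0[OF i]
        by (simp add: power_mult_distrib mult_left_mono flip: sum_distrib_left)
    qed
    finally show ?thesis .
  qed
  have "((\<lambda>(x, j). ell2_norm_sq (K x j ?w)) has_sum ell2_norm_sq ?w) UNIV"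
    using K w by (simp add: quantum_instrument_def)
  then show ?thesis
  proof (rule has_sum_le_finite_sums)
    fix F :: "('x \<times> nat) set" assume F: "finite F" "F \<subseteq> UNIV"
    have "(\<Sum>(x, j)\<in>F. ell2_norm_sq (K x j ?w)) \<le> (\<Sum>(x, j)\<in>(fst ` F \<union> X) \<times> snd ` F. ell2_norm_sq (K x j ?w))"
      using F X by (intro sum_mono2) (force simp: image_iff)+
    also have "\<dots> = (\<Sum>x\<in>fst ` F \<union> X. \<Sum>j\<in>snd ` F. ell2_norm_sq (K x j ?w))"
      by (simp add: sum.cartesian_product)
    also have "\<dots> \<le> (\<Sum>x\<in>fst ` F \<union> X. ?R x)"
      using F by (intro sum_mono outcome) simp
    also have "\<dots> = (\<Sum>x\<in>X. ?R x)"
      using F X by (intro sum.mono_neutral_right) auto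
    finally show "(\<Sum>(x, j)\<in>F. ell2_norm_sq (K x j ?w)) \<le> (\<Sum>x\<in>X. ?R x)" .
  qed
qed

lemma cmod_sum_cnj_mult_le:
  "(cmod (\<Sum>a\<in>F. cnj (v a) * w a))\<^sup>2 \<le> (\<Sum>a\<in>F. (cmod (v a))\<^sup>2) * (\<Sum>a\<in>F. (cmod (w a))\<^sup>2)"
proof -
  have "cmod (\<Sum>a\<in>F. cnj (v a) * w a) \<le> (\<Sum>a\<in>F. cmod (v a) * cmod (w a))"
    by (rule order_trans[OF norm_sum]) (simp add: norm_mult)
  then have "(cmod (\<Sum>a\<in>F. cnj (v a) * w a))\<^sup>2 \<le> (\<Sum>a\<in>F. cmod (v a) * cmod (w a))\<^sup>2"
    by (intro power_mono) auto
  also have "\<dots> \<le> (\<Sum>a\<in>F. (cmod (v a))\<^sup>2) * (\<Sum>a\<in>F. (cmod (w a))\<^sup>2)"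
    by (rule Cauchy_Schwarz_ineq_sum)
  finally show ?thesis .
qed

text \<open>With \<open>z i = \<langle>v, \<psi> i\<rangle>\<close>, the left-hand side \<open>N\<close> of the conclusion is \<open>\<langle>v, w\<rangle>\<close> for the vector
  \<open>w = \<Sum>i. \<pi> i * cnj (z i) * \<psi> i\<close>, whose squared norm is at most \<open>l * N\<close>. The assumption \<open>gap\<close> says that
  the matrix \<open>sqrt (\<pi> i * t i x)\<close> has squared operator norm at most \<open>l\<close>.\<close>

lemma instrument_ensemble_bound:
  fixes K :: "'x \<Rightarrow> nat \<Rightarrow> (nat \<Rightarrow> complex) \<Rightarrow> nat \<Rightarrow> complex"
  assumes K: "quantum_instrument I K" and S: "finite S"
    and \<psi>: "\<And>i. i \<in> S \<Longrightarrow> \<psi> i \<in> ell2 I"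
    and t: "\<And>i x. i \<in> S \<Longrightarrow> ((\<lambda>j. ell2_norm_sq (K x j (\<psi> i))) has_sum t i x) UNIV"
    and X: "finite X" "\<And>i x. i \<in> S \<Longrightarrow> x \<notin> X \<Longrightarrow> t i x = 0"
    and \<pi>: "\<And>i. i \<in> S \<Longrightarrow> 0 \<le> \<pi> i"
    and gap: "\<And>d. (\<Sum>x\<in>X. (\<Sum>i\<in>S. \<pi> i * d i * sqrt (t i x))\<^sup>2) \<le> l * (\<Sum>i\<in>S. \<pi> i * (d i)\<^sup>2)"
    and F: "finite F" and l: "0 \<le> l"
  shows "(\<Sum>i\<in>S. \<pi> i * (cmod (\<Sum>a\<in>F. cnj (v a) * \<psi> i a))\<^sup>2) \<le> l * (\<Sum>a\<in>F. (cmod (v a))\<^sup>2)"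
proof -
  define z where "z i = (\<Sum>a\<in>F. cnj (v a) * \<psi> i a)" for i
  define N where "N = (\<Sum>i\<in>S. \<pi> i * (cmod (z i))\<^sup>2)"
  define c where "c i = of_real (\<pi> i) * cnj (z i)" for i
  let ?w = "\<lambda>a. \<Sum>i\<in>S. c i * \<psi> i a"
  let ?V = "\<Sum>a\<in>F. (cmod (v a))\<^sup>2"
  have N0: "0 \<le> N" unfolding N_def by (intro sum_nonneg) (simp add: \<pi>)
  have V0: "0 \<le> ?V" by (intro sum_nonneg) simp
  have "(\<Sum>a\<in>F. cnj (v a) * ?w a) = (\<Sum>i\<in>S. c i * z i)"
    unfolding z_def sum_distrib_left by (subst sum.swap) (simp add: mult_ac)
  also have "\<dots> = of_real N"
    unfolding N_def c_def of_real_sum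
    by (intro sum.cong refl) (simp add: mult.assoc complex_norm_square mult.commute[of "cnj _"] del: of_real_power)
  finally have "N\<^sup>2 = (cmod (\<Sum>a\<in>F. cnj (v a) * ?w a))\<^sup>2" by simp
  also have "\<dots> \<le> ?V * (\<Sum>a\<in>F. (cmod (?w a))\<^sup>2)"
    by (rule cmod_sum_cnj_mult_le)
  also have "\<dots> \<le> ?V * ell2_norm_sq ?w"
    by (intro mult_left_mono sum_le_ell2_norm_sq[OF ell2_linear_combination[OF S \<psi>]] F V0)
  also have "ell2_norm_sq ?w \<le> (\<Sum>x\<in>X. (\<Sum>i\<in>S. cmod (c i) * sqrt (t i x))\<^sup>2)"
    by (rule instrument_norm_sq_linear_combination[OF K S \<psi> t X])
  also have "\<dots> = (\<Sum>x\<in>X. (\<Sum>i\<in>S. \<pi> i * cmod (z i) * sqrt (t i x))\<^sup>2)"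
    by (intro sum.cong refl arg_cong[where f="\<lambda>r. r\<^sup>2"]) (simp add: c_def norm_mult \<pi>)
  also have "\<dots> \<le> l * N"
    using gap[of "\<lambda>i. cmod (z i)"] by (simp add: N_def)
  finally have "N\<^sup>2 \<le> ?V * (l * N)"
    using V0 by (simp add: mult_left_mono)
  then have "N * N \<le> (l * ?V) * N" by (simp add: power2_eq_square mult_ac)
  then have "N \<le> l * ?V"
    using N0 V0 l by (cases "N = 0") auto
  then show ?thesis by (simp add: N_def z_def)
qed

section \<open>Averages over pasts\<close>

context first_symbol_markov begin

lemma integrable_first_symbol:
  assumes g: "g \<in> borel_measurable seq_space" "\<And>p. \<bar>g p\<bar> \<le> (B::real)"
  shows "integrable (past_law M) (\<lambda>p. g p * indicator {q. q 0 = i} p)"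
proof (rule past.integrable_const_bound[of _ B])
  have "0 \<le> B" using g(2)[of undefined] by linarith
  then show "AE p in past_law M. norm (g p * indicator {q. q 0 = i} p) \<le> B"
    using g(2) by (intro AE_I2) (auto simp: indicator_def)
  show "(\<lambda>p. g p * indicator {q. q 0 = i} p) \<in> borel_measurable (past_law M)"
    using g(1) by (intro borel_measurable_times borel_measurable_indicator)
      (simp_all add: sets_first measurable_cong_sets[OF sets_past_law refl])
qed

text \<open>A pointwise bound \<open>D / \<pi> i\<close> on an event of probability
  \<open>\<pi> i\<close> integrates to \<open>D\<close>.\<close>

lemma integral_first_symbol_le:
  assumes i: "i < n" and g: "g \<in> borel_measurable seq_space" "\<And>p. \<bar>g p\<bar> \<le> B"
    and AE: "AE p in past_law M. p 0 = i \<longrightarrow> \<pi> i * g p \<le> D"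
  shows "(\<integral>p. g p * indicator {q. q 0 = i} p \<partial>past_law M) \<le> D"
proof -
  have pi: "0 < \<pi> i" by (rule \<pi>_pos[OF i])
  have m: "{q::nat \<Rightarrow> nat. q 0 = i} \<in> sets (past_law M)" by (simp add: sets_first)
  have "(\<integral>p. g p * indicator {q. q 0 = i} p \<partial>past_law M)
      \<le> (\<integral>p. D / \<pi> i * indicator {q. q 0 = i} p \<partial>past_law M)"
  proof (rule integral_mono_AE)
    show "integrable (past_law M) (\<lambda>p. g p * indicator {q. q 0 = i} p)"
      by (rule integrable_first_symbol[OF g])
    show "integrable (past_law M) (\<lambda>p. D / \<pi> i * indicator {q. q 0 = i} p)"
      using m by (intro integrable_mult_right) (simp add: integrable_indicator_iff past.emeasure_finite less_top[symmetric])
    show "AE p in past_law M. g p * indicator {q. q 0 = i} p \<le> D / \<pi> i * indicator {q. q 0 = i} p"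
      using AE pi by (elim AE_mp) (auto intro!: AE_I2 simp: indicator_def field_simps)
  qed
  also have "\<dots> = D / \<pi> i * measure (past_law M) {q. q 0 = i}" using m by simp
  also have "measure (past_law M) {q. q 0 = i} = \<pi> i"
    using pi by (simp add: measure_def first_symbol)
  finally show ?thesis using pi by simp
qed

lemma integral_split_first_symbol:
  fixes g :: "(nat \<Rightarrow> nat) \<Rightarrow> real"
  assumes g: "g \<in> borel_measurable seq_space"
    and int: "\<And>i. integrable (past_law M) (\<lambda>p. g p * indicator {q. q 0 = i} p)"
  shows "(\<integral>p. g p \<partial>past_law M) = (\<Sum>i<n. \<integral>p. g p * indicator {q. q 0 = i} p \<partial>past_law M)"
proof -
  have "(\<integral>p. g p \<partial>past_law M) = (\<integral>p. (\<Sum>i<n. g p * indicator {q. q 0 = i} p) \<partial>past_law M)"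
  proof (rule integral_cong_AE)
    show "AE p in past_law M. g p = (\<Sum>i<n. g p * indicator {q. q 0 = i} p)"
      using AE_first
    proof (elim AE_mp, intro AE_I2 impI)
      fix p :: "nat \<Rightarrow> nat" assume "p 0 < n"
      then show "g p = (\<Sum>i<n. g p * indicator {q. q 0 = i} p)"
        by (subst sum.remove[of _ "p 0"]) (auto intro!: sum.neutral simp: indicator_def)
    qed
    show "g \<in> borel_measurable (past_law M)"
      using g by (simp add: measurable_cong_sets[OF sets_past_law refl])
    show "(\<lambda>p. \<Sum>i<n. g p * indicator {q. q 0 = i} p) \<in> borel_measurable (past_law M)"
      by (intro borel_measurable_sum borel_measurable_integrable int)
  qed
  also have "\<dots> = (\<Sum>i<n. \<integral>p. g p * indicator {q. q 0 = i} p \<partial>past_law M)"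
    by (rule Bochner_Integration.integral_sum) (rule int)
  finally show ?thesis .
qed

text \<open>The representatives \<open>p i\<close> are averaged over the pasts ending in \<open>i\<close> one \<open>i\<close> at a time.\<close>

lemma integral_le_representatives:
  assumes g: "g \<in> borel_measurable seq_space" "\<And>p. \<bar>g p\<bar> \<le> B"
    and good: "AE p in past_law M. P p"
    and le: "\<And>p. (\<And>i. i < n \<Longrightarrow> P (p i) \<and> p i 0 = i) \<Longrightarrow> (\<Sum>i<n. \<pi> i * g (p i)) \<le> C"
  shows "(\<integral>p. g p \<partial>past_law M) \<le> C"
proof -
  let ?G = "\<lambda>i. \<integral>p. g p * indicator {q. q 0 = i} p \<partial>past_law M"
  have partial: "(\<Sum>i<k. ?G i) + (\<Sum>i\<in>{k..<n}. \<pi> i * g (p i)) \<le> C"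
    if "k \<le> n" "\<And>i. i < n \<Longrightarrow> P (p i) \<and> p i 0 = i" for k p
    using that
  proof (induction k arbitrary: p)
    case 0
    then show ?case using le[of p] by (simp add: atLeast0LessThan)
  next
    case (Suc k)
    let ?D = "C - (\<Sum>i<k. ?G i) - (\<Sum>i\<in>{Suc k..<n}. \<pi> i * g (p i))"
    have "AE q in past_law M. q 0 = k \<longrightarrow> \<pi> k * g q \<le> ?D"
      using good
    proof (elim AE_mp, intro AE_I2 impI)
      fix q assume q: "P q" "q 0 = k"
      \<comment> \<open>The representative of \<open>k\<close> is replaced by an arbitrary good past
        \<open>q\<close>; what the induction hypothesis then says about \<open>g q\<close> is a
        bound independent of \<open>q\<close>.\<close>
      have "(\<Sum>i<k. ?G i) + (\<Sum>i\<in>{k..<n}. \<pi> i * g ((p(k := q)) i)) \<le> C"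
        using Suc.prems q by (intro Suc.IH) auto
      moreover have "(\<Sum>i\<in>{k..<n}. \<pi> i * g ((p(k := q)) i))
          = \<pi> k * g q + (\<Sum>i\<in>{Suc k..<n}. \<pi> i * g (p i))"
        using Suc.prems(1) by (subst sum.atLeast_Suc_lessThan) auto
      ultimately show "\<pi> k * g q \<le> ?D" by linarith
    qed
    then have "?G k \<le> ?D"
      using Suc.prems(1) by (intro integral_first_symbol_le[OF _ g]) auto
    then show ?case by simp
  qed
  \<comment> \<open>Representatives exist because ending in \<open>i\<close> has positive
    probability, so \<open>P\<close> cannot fail on that whole event.\<close>
  have "\<exists>p. P p \<and> p 0 = i" if i: "i < n" for i
  proof (rule ccontr)
    assume no: "\<nexists>p. P p \<and> p 0 = i"
    have "AE p in past_law M. p \<notin> {q. q 0 = i}"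
      using good by (elim AE_mp) (use no in \<open>auto intro!: AE_I2\<close>)
    then have "emeasure (past_law M) {q. q 0 = i} = 0"
      using AE_iff_measurable[of "{q. q 0 = i}" "past_law M" "\<lambda>p. p \<notin> {q. q 0 = i}"]
      by (auto simp: sets_first)
    then show False using \<pi>_pos[OF i] by (simp add: first_symbol)
  qed
  then obtain p where "\<And>i. i < n \<Longrightarrow> P (p i) \<and> p i 0 = i" by metis
  then have "(\<Sum>i<n. ?G i) \<le> C" using partial[of n p] by simp
  then show ?thesis
    by (simp add: integral_split_first_symbol[OF g(1) integrable_first_symbol[OF g]])
qed

section \<open>The average state as an integral\<close>

lemma encoding_component_le:
  assumes "quantum_model M Q"
  shows "cmod (encoding Q p a) \<le> 1"
proof -
  have "encoding Q p \<in> pure_states (system Q)"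
    using assms by (auto simp: quantum_model_def)
  then have "(cmod (encoding Q p a))\<^sup>2 \<le> 1"
    using sum_le_ell2_norm_sq[of "encoding Q p" "system Q" "{a}"] by (simp add: pure_states_def)
  then show ?thesis by (simp add: power_le_one_iff abs_square_le_1)
qed

lemma encoding_measurable:
  "quantum_model M Q \<Longrightarrow> (\<lambda>p. encoding Q p a) \<in> borel_measurable (past_law M)"
  by (simp add: quantum_model_def measurable_cong_sets[OF sets_past_law refl])

lemma encoding_integrable:
  assumes Q: "quantum_model M Q"
  shows "integrable (past_law M) (\<lambda>p. encoding Q p a * cnj (encoding Q p b))"
proof (rule past.integrable_const_bound[of _ 1])
  show "(\<lambda>p. encoding Q p a * cnj (encoding Q p b)) \<in> borel_measurable (past_law M)"
    by (intro borel_measurable_times encoding_measurable[OF Q]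
        measurable_compose[OF encoding_measurable[OF Q] borel_measurable_continuous_onI])
      (intro continuous_intros)
  show "AE p in past_law M. cmod (encoding Q p a * cnj (encoding Q p b)) \<le> 1"
    using encoding_component_le[OF Q] by (intro AE_I2) (simp add: norm_mult mult_le_one)
qed

text \<open>Translates the matrix of the average state into a mean of squared overlaps, the form in
  which \<open>integral_le_representatives\<close> applies. A test vector of finite support leaves
  only finite sums to exchange with the integral.\<close>

lemma average_state_quadratic_form:
  assumes Q: "quantum_model M Q" and F: "finite F"
  shows "(\<Sum>a\<in>F. \<Sum>b\<in>F. cnj (v a) * v b * average_state M Q a b)
    = of_real (\<integral>p. (cmod (\<Sum>a\<in>F. cnj (v a) * encoding Q p a))\<^sup>2 \<partial>past_law M)"
proof -
  have "(\<Sum>a\<in>F. \<Sum>b\<in>F. cnj (v a) * v b * average_state M Q a b)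
      = (\<integral>p. (\<Sum>a\<in>F. \<Sum>b\<in>F. cnj (v a) * v b * (encoding Q p a * cnj (encoding Q p b))) \<partial>past_law M)"
    unfolding average_state_def
    by (simp add: Bochner_Integration.integral_sum encoding_integrable[OF Q])
  also have "\<dots> = (\<integral>p. complex_of_real ((cmod (\<Sum>a\<in>F. cnj (v a) * encoding Q p a))\<^sup>2) \<partial>past_law M)"
    unfolding complex_norm_square cnj_sum sum_product
    by (intro Bochner_Integration.integral_cong refl sum.cong) (simp add: mult_ac)
  also have "\<dots> = of_real (\<integral>p. (cmod (\<Sum>a\<in>F. cnj (v a) * encoding Q p a))\<^sup>2 \<partial>past_law M)"
    by (rule integral_complex_of_real)
  finally show ?thesis .
qed

end

section \<open>Entropy of distributions with bounded weights\<close>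

definition binary_entropy :: "real \<Rightarrow> real" where
  "binary_entropy q = - q * log 2 q - (1 - q) * log 2 (1 - q)"

lemma binary_entropy_half: "binary_entropy (1/2) = 1"
  by (simp add: binary_entropy_def log_divide)

text \<open>The derivative at \<open>x\<close> is \<open>log 2 ((1 - x) / x)\<close>, which is at
  most 0 from 1/2 on.\<close>

lemma binary_entropy_antimono:
  assumes "1/2 \<le> m" "m \<le> l" "l < 1"
  shows "binary_entropy l \<le> binary_entropy m"
proof (rule DERIV_nonpos_imp_nonincreasing[OF assms(2)])
  fix x assume x: "m \<le> x" "x \<le> l"
  have "((\<lambda>q. (- (q * ln q) - (1 - q) * ln (1 - q)) / ln 2) has_real_derivative
      (- (1 * ln x + 1 / x * x) - ((0 - 1) * ln (1 - x) + 1 / (1 - x) * (0 - 1) * (1 - x))) / ln 2) (at x)"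
    using x assms by (auto intro!: derivative_eq_intros)
  moreover have "binary_entropy = (\<lambda>q. (- (q * ln q) - (1 - q) * ln (1 - q)) / ln 2)"
    by (simp add: fun_eq_iff binary_entropy_def log_def diff_divide_distrib)
  moreover have "(- (1 * ln x + 1 / x * x) - ((0 - 1) * ln (1 - x) + 1 / (1 - x) * (0 - 1) * (1 - x))) / ln 2
      = log 2 (1 - x) - log 2 x"
    using x assms by (simp add: log_def diff_divide_distrib)
  ultimately have "(binary_entropy has_real_derivative (log 2 (1 - x) - log 2 x)) (at x)"
    by simp
  moreover have "log 2 (1 - x) - log 2 x \<le> 0"
    using x assms by simp
  ultimately show "\<exists>y. (binary_entropy has_real_derivative y) (at x) \<and> y \<le> 0" by blast
qed

text \<open>A linear minorant of the entropy, from monotonicity of the logarithm. It is used with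
  \<open>b\<close> equal to 1/2, and to the weight left over by one large eigenvalue.\<close>

lemma entropy_term_ge:
  assumes "0 \<le> q" "q \<le> b" "b \<le> 1"
  shows "ennreal (- log 2 b) * ennreal q \<le> entropy_term q"
proof (cases "q = 0")
  case False
  then have "q * log 2 q \<le> q * log 2 b"
    using assms by (intro mult_left_mono) auto
  then show ?thesis
    using assms False unfolding entropy_term_def
    by (subst ennreal_mult'[symmetric]) (auto simp: mult_ac intro!: ennreal_leI)
qed simp

lemma nn_integral_count_space_remove:
  assumes "k \<in> I"
  shows "(\<integral>\<^sup>+x. f x \<partial>count_space I) = f k + (\<integral>\<^sup>+x. f x \<partial>count_space (I - {k}))"
proof -
  have "{k} \<union> (I - {k}) = I" using assms by blast
  then show ?thesis
    using nn_integral_disjoint_pair_countspace[of "{k}" "I - {k}" f]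
    by (simp add: nn_integral_count_space_finite) (simp add: nn_integral_count_space_indicator)
qed

text \<open>If all weights are at most 1/2, the entropy is at least 1. Otherwise one weight
  \<open>m\<close> exceeds 1/2, and the others sum to \<open>1 - m\<close>, so each is at most
  \<open>1 - m\<close> and together they contribute at least
  \<open>- (1 - m) * log 2 (1 - m)\<close>. The total is at least \<open>binary_entropy m\<close>,
  which is at least \<open>binary_entropy l\<close> because \<open>m \<le> l\<close>.\<close>

lemma binary_entropy_le_entropy:
  assumes l: "1/2 \<le> l" "l < 1"
    and \<mu>: "\<And>k. k \<in> I \<Longrightarrow> 0 \<le> \<mu> k" "\<And>k. k \<in> I \<Longrightarrow> \<mu> k \<le> l"
    and total: "(\<integral>\<^sup>+k. ennreal (\<mu> k) \<partial>count_space I) = 1"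
  shows "ennreal (binary_entropy l) \<le> (\<integral>\<^sup>+k. entropy_term (\<mu> k) \<partial>count_space I)"
proof (cases "\<forall>k\<in>I. \<mu> k \<le> 1/2")
  case True
  have "ennreal (binary_entropy l) \<le> ennreal 1"
    using binary_entropy_antimono[of "1/2" l] l binary_entropy_half by (intro ennreal_leI) simp
  also have "\<dots> = (\<integral>\<^sup>+k. ennreal (\<mu> k) \<partial>count_space I)" by (simp add: total)
  also have "\<dots> \<le> (\<integral>\<^sup>+k. entropy_term (\<mu> k) \<partial>count_space I)"
  proof (rule nn_integral_mono)
    fix k assume "k \<in> space (count_space I)"
    then show "ennreal (\<mu> k) \<le> entropy_term (\<mu> k)"
      using entropy_term_ge[of "\<mu> k" "1/2"] True \<mu>(1) by (simp add: log_divide)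
  qed
  finally show ?thesis .
next
  case False
  then obtain k where k: "k \<in> I" "1/2 < \<mu> k" by (auto simp: not_le)
  let ?m = "\<mu> k" and ?J = "count_space (I - {k})"
  have m: "?m \<le> l" "0 \<le> ?m" using k \<mu> by auto
  have split: "1 = ennreal ?m + (\<integral>\<^sup>+j. ennreal (\<mu> j) \<partial>?J)"
    using nn_integral_count_space_remove[OF k(1), of "\<lambda>j. ennreal (\<mu> j)"] total by simp
  then have rest: "(\<integral>\<^sup>+j. ennreal (\<mu> j) \<partial>?J) = ennreal (1 - ?m)"
    using m l by (metis ennreal_1 ennreal_add_diff_cancel_left ennreal_minus ennreal_neq_top)
  have small: "\<mu> j \<le> 1 - ?m" if j: "j \<in> I - {k}" for j
  proof -
    have "ennreal (\<mu> j) \<le> ennreal (1 - ?m)"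
      unfolding rest[symmetric] nn_integral_count_space_remove[OF j, of "\<lambda>j. ennreal (\<mu> j)"] by simp
    then show ?thesis using m l by (simp add: ennreal_le_iff)
  qed
  have "ennreal (binary_entropy l) \<le> ennreal (binary_entropy ?m)"
    using binary_entropy_antimono[of ?m l] k l m by (intro ennreal_leI) simp
  also have "\<dots> = entropy_term ?m + ennreal (- log 2 (1 - ?m)) * ennreal (1 - ?m)"
  proof -
    have "0 \<le> - log 2 (1 - ?m)" "0 \<le> - ?m * log 2 ?m"
      using k l m by (auto simp: mult_le_0_iff)
    then show ?thesis
      using k l m unfolding binary_entropy_def entropy_term_def
      by (subst ennreal_mult'[symmetric], simp, subst ennreal_plus[symmetric])
        (auto simp: algebra_simps intro!: mult_nonneg_nonneg)
  qed
  also have "\<dots> = entropy_term ?m + (\<integral>\<^sup>+j. ennreal (- log 2 (1 - ?m)) * ennreal (\<mu> j) \<partial>?J)"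
    by (simp add: nn_integral_cmult rest)
  also have "\<dots> \<le> entropy_term ?m + (\<integral>\<^sup>+j. entropy_term (\<mu> j) \<partial>?J)"
    using small k l \<mu>(1) by (intro add_left_mono nn_integral_mono entropy_term_ge) auto
  also have "\<dots> = (\<integral>\<^sup>+k. entropy_term (\<mu> k) \<partial>count_space I)"
    by (rule nn_integral_count_space_remove[OF k(1), symmetric])
  finally show ?thesis .
qed

lemma nn_integral_count_space_has_sum:
  fixes f :: "nat \<Rightarrow> real"
  assumes f: "(f has_sum s) I" and pos: "\<And>k. k \<in> I \<Longrightarrow> 0 \<le> f k"
  shows "(\<integral>\<^sup>+k. ennreal (f k) \<partial>count_space I) = ennreal s"
proof -
  let ?f = "\<lambda>k. if k \<in> I then f k else 0"
  have "(?f has_sum s) UNIV"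
    using f by (subst has_sum_cong_neutral[where T=I and g=f]) auto
  then have "?f sums s" by (rule has_sum_imp_sums)
  then have "(\<Sum>k. ennreal (?f k)) = ennreal s"
    using pos by (intro suminf_ennreal_eq) auto
  moreover have "(\<integral>\<^sup>+k. ennreal (f k) \<partial>count_space I) = (\<integral>\<^sup>+k. ennreal (?f k) \<partial>count_space UNIV)"
    by (subst nn_integral_count_space_indicator) (auto intro!: nn_integral_cong simp: indicator_def)
  ultimately show ?thesis by (simp add: nn_integral_count_space_nat)
qed

lemma has_sum_ell2_norm_sq:
  "\<psi> \<in> ell2 I \<Longrightarrow> ((\<lambda>a. (cmod (\<psi> a))\<^sup>2) has_sum ell2_norm_sq \<psi>) UNIV"
  unfolding ell2_def ell2_norm_sq_def by (auto intro: has_sum_infsum)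

lemma ell2_inner_self:
  assumes "\<psi> \<in> ell2 I"
  shows "ell2_inner \<psi> \<psi> = of_real (ell2_norm_sq \<psi>)"
proof -
  have "((\<lambda>a. complex_of_real ((cmod (\<psi> a))\<^sup>2)) has_sum of_real (ell2_norm_sq \<psi>)) UNIV"
    by (rule has_sum_of_real[OF has_sum_ell2_norm_sq[OF assms]])
  then have "((\<lambda>a. cnj (\<psi> a) * \<psi> a) has_sum of_real (ell2_norm_sq \<psi>)) UNIV"
    by (simp add: complex_norm_square mult.commute del: of_real_power)
  then show ?thesis
    unfolding ell2_inner_def by (rule infsumI)
qed

section \<open>Lower bound for quantum models\<close>

lemma spectral_decomposition_norm:
  assumes "spectral_decomposition I \<rho> e \<mu>" "k \<in> I"
  shows "e k \<in> ell2 I" "ell2_norm_sq (e k) = 1" "0 \<le> \<mu> k"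
proof -
  show e: "e k \<in> ell2 I" and "0 \<le> \<mu> k"
    using assms by (auto simp: spectral_decomposition_def)
  have "ell2_inner (e k) (e k) = 1"
    using assms by (auto simp: spectral_decomposition_def)
  then show "ell2_norm_sq (e k) = 1"
    unfolding ell2_inner_self[OF e] by simp
qed

lemma has_sum_finite_sum:
  fixes f :: "'a \<Rightarrow> 'b \<Rightarrow> 'c::topological_comm_monoid_add"
  assumes "finite F" "\<And>a. a \<in> F \<Longrightarrow> (f a has_sum s a) I"
  shows "((\<lambda>l. \<Sum>a\<in>F. f a l) has_sum (\<Sum>a\<in>F. s a)) I"
  using assms by (induction F rule: finite_induct) (auto intro: has_sum_add)

text \<open>The quadratic form is the sum over \<open>l\<close> of the nonnegative numbers
  \<open>\<mu> l\<close> times the squared overlap of \<open>v\<close> with \<open>e l\<close>, so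
  it dominates each of them.\<close>

lemma spectral_decomposition_quadratic_form:
  assumes sd: "spectral_decomposition I \<rho> e \<mu>" and k: "k \<in> I" and F: "finite F"
    and E: "(\<Sum>a\<in>F. \<Sum>b\<in>F. cnj (v a) * v b * \<rho> a b) = of_real E"
  shows "\<mu> k * (cmod (\<Sum>a\<in>F. cnj (v a) * e k a))\<^sup>2 \<le> E"
proof -
  let ?q = "\<lambda>l. \<mu> l * (cmod (\<Sum>a\<in>F. cnj (v a) * e l a))\<^sup>2"
  have "((\<lambda>l. \<Sum>a\<in>F. \<Sum>b\<in>F. cnj (v a) * v b * (of_real (\<mu> l) * e l a * cnj (e l b)))
      has_sum (\<Sum>a\<in>F. \<Sum>b\<in>F. cnj (v a) * v b * \<rho> a b)) I"
    using sd F unfolding spectral_decomposition_def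
    by (intro has_sum_finite_sum has_sum_cmult_right) auto
  moreover have "(\<Sum>a\<in>F. \<Sum>b\<in>F. cnj (v a) * v b * (of_real (\<mu> l) * e l a * cnj (e l b))) = of_real (?q l)" for l
    unfolding of_real_mult complex_norm_square cnj_sum
    unfolding sum_product unfolding sum_distrib_left
    by (intro sum.cong refl) (simp add: mult_ac)
  ultimately have "((\<lambda>l. complex_of_real (?q l)) has_sum of_real E) I"
    by (simp only: E)
  then have "(?q has_sum E) I"
    by (simp only: has_sum_of_real_iff)
  then have "sum ?q {k} \<le> E"
    using k spectral_decomposition_norm[OF sd] by (intro finite_sum_le_has_sum) auto
  then show ?thesis by simp
qed

text \<open>Tonelli for the nonnegative double family
  \<open>\<mu> k * (cmod (e k a))\<^sup>2\<close>: summing over \<open>a\<close> gives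
  \<open>\<mu> k\<close>, as \<open>e k\<close> is a unit vector, and summing over \<open>k\<close>
  gives the diagonal entry at \<open>a\<close>.\<close>

lemma spectral_decomposition_trace:
  assumes sd: "spectral_decomposition I \<rho> e \<mu>" and \<rho>: "\<And>a. \<rho> a a = of_real (r a)"
  shows "(\<integral>\<^sup>+k. ennreal (\<mu> k) \<partial>count_space I) = (\<integral>\<^sup>+a. ennreal (r a) \<partial>count_space UNIV)"
proof -
  have "(\<integral>\<^sup>+k. ennreal (\<mu> k) \<partial>count_space I)
      = (\<integral>\<^sup>+k. \<integral>\<^sup>+a. ennreal (\<mu> k * (cmod (e k a))\<^sup>2) \<partial>count_space UNIV \<partial>count_space I)"
  proof (rule nn_integral_cong)
    fix k assume "k \<in> space (count_space I)"
    then have k: "k \<in> I" by simp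
    note e = spectral_decomposition_norm[OF sd k]
    have "((\<lambda>a. \<mu> k * (cmod (e k a))\<^sup>2) has_sum (\<mu> k * 1)) UNIV"
      using has_sum_ell2_norm_sq[OF e(1)] e(2) by (intro has_sum_cmult_right) simp
    then show "ennreal (\<mu> k) = (\<integral>\<^sup>+a. ennreal (\<mu> k * (cmod (e k a))\<^sup>2) \<partial>count_space UNIV)"
      using e(3) by (subst nn_integral_count_space_has_sum) auto
  qed
  also have "\<dots> = (\<integral>\<^sup>+a. \<integral>\<^sup>+k. ennreal (\<mu> k * (cmod (e k a))\<^sup>2) \<partial>count_space I \<partial>count_space UNIV)"
    by (rule nn_integral_count_space_nn_integral) simp_all
  also have "\<dots> = (\<integral>\<^sup>+a. ennreal (r a) \<partial>count_space UNIV)"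
  proof (rule nn_integral_cong)
    fix a
    have "((\<lambda>k. of_real (\<mu> k) * e k a * cnj (e k a)) has_sum of_real (r a)) I"
      using sd \<rho>[of a] unfolding spectral_decomposition_def by metis
    then have "((\<lambda>k. complex_of_real (\<mu> k * (cmod (e k a))\<^sup>2)) has_sum of_real (r a)) I"
      by (simp add: complex_norm_square mult.assoc del: of_real_power)
    then have "((\<lambda>k. \<mu> k * (cmod (e k a))\<^sup>2) has_sum r a) I"
      by (simp only: has_sum_of_real_iff)
    then show "(\<integral>\<^sup>+k. ennreal (\<mu> k * (cmod (e k a))\<^sup>2) \<partial>count_space I) = ennreal (r a)"
      using spectral_decomposition_norm[OF sd] by (intro nn_integral_count_space_has_sum) auto
  qed
  finally show ?thesis .
qed

context first_symbol_markov begin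

text \<open>The average state is tested with the truncated eigenvector \<open>v\<close>, whose
  overlap with \<open>e k\<close> is its own squared norm \<open>?s m\<close>. The spectral side is
  at least \<open>\<mu> k * (?s m)\<^sup>2\<close>, the instrument bounds it by
  \<open>l * ?s m\<close>, and \<open>?s m\<close> tends to 1.\<close>

lemma eigenvalue_le:
  assumes Q: "quantum_model M Q"
    and sd: "spectral_decomposition (system Q) (average_state M Q) e \<mu>" and k: "k \<in> system Q"
    and gap: "\<And>d. (\<Sum>x<n. (\<Sum>i<n. \<pi> i * d i * sqrt (T i x))\<^sup>2) \<le> l * (\<Sum>i<n. \<pi> i * (d i)\<^sup>2)"
    and l: "0 \<le> l"
  shows "\<mu> k \<le> l"
proof -
  \<comment> \<open>truncating the eigenvector to its first \<open>m\<close> entries keeps all sums finite\<close>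
  let ?s = "\<lambda>m. \<Sum>a<m. (cmod (e k a))\<^sup>2"
  have bound: "\<mu> k * (?s m)\<^sup>2 \<le> l * ?s m" for m
  proof -
    let ?g = "\<lambda>p. (cmod (\<Sum>a<m. cnj (e k a) * encoding Q p a))\<^sup>2"
    have "(\<integral>p. ?g p \<partial>past_law M) \<le> l * ?s m"
    proof (rule integral_le_representatives)
      show "?g \<in> borel_measurable seq_space"
      proof -
        have "(\<lambda>p. encoding Q p a) \<in> borel_measurable seq_space" for a
          using Q by (simp add: quantum_model_def)
        then show ?thesis
          by (intro borel_measurable_power measurable_compose[OF _ borel_measurable_norm] borel_measurable_sum
              borel_measurable_times borel_measurable_const)
      qed
    next
      fix p
      have "cmod (\<Sum>a<m. cnj (e k a) * encoding Q p a) \<le> (\<Sum>a<m. cmod (e k a) * 1)"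
        by (rule order_trans[OF norm_sum])
          (auto simp: norm_mult intro!: sum_mono mult_left_le encoding_component_le[OF Q])
      then have "?g p \<le> (\<Sum>a<m. cmod (e k a) * 1)\<^sup>2" by (rule power_mono) simp
      then show "\<bar>?g p\<bar> \<le> (\<Sum>a<m. cmod (e k a) * 1)\<^sup>2" by simp
    next
      show "AE p in past_law M. \<forall>x. ((\<lambda>j. ell2_norm_sq (kraus Q x j (encoding Q p))) has_sum T (p 0) x) UNIV"
      proof -
        have "AE p in past_law M. \<forall>x. ((\<lambda>j. ell2_norm_sq (kraus Q x j (encoding Q p))) has_sum cond_next M p x) UNIV"
          using Q unfolding quantum_model_def by (elim conjE, elim eventually_mono) blast
        with AE_cond_next show ?thesis by eventually_elim simp
      qed
    next
      fix p :: "nat \<Rightarrow> nat \<Rightarrow> nat"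
      assume p: "\<And>i. i < n \<Longrightarrow>
        (\<forall>x. ((\<lambda>j. ell2_norm_sq (kraus Q x j (encoding Q (p i)))) has_sum T (p i 0) x) UNIV) \<and> p i 0 = i"
      show "(\<Sum>i<n. \<pi> i * ?g (p i)) \<le> l * ?s m"
      proof (rule instrument_ensemble_bound[where I="system Q" and K="kraus Q" and t=T and X="{..<n}"])
        show "quantum_instrument (system Q) (kraus Q)"
          using Q by (simp add: quantum_model_def)
        show "encoding Q (p i) \<in> ell2 (system Q)" for i
          using Q by (auto simp: quantum_model_def pure_states_def)
        show "((\<lambda>j. ell2_norm_sq (kraus Q x j (encoding Q (p i)))) has_sum T i x) UNIV" if "i \<in> {..<n}" for i x
          using p[of i] that by (metis lessThan_iff)
      qed (use gap l \<pi>_pos T_support in \<open>auto simp: less_imp_le\<close>)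
    qed
    moreover have "\<mu> k * (cmod (\<Sum>a<m. cnj (e k a) * e k a))\<^sup>2 \<le> (\<integral>p. ?g p \<partial>past_law M)"
      by (rule spectral_decomposition_quadratic_form[OF sd k])
        (simp_all only: average_state_quadratic_form[OF Q] finite_lessThan)
    moreover have "(\<Sum>a<m. cnj (e k a) * e k a) = of_real (?s m)"
      by (simp add: complex_norm_square mult.commute del: of_real_power)
    ultimately show ?thesis
      by (simp only: norm_of_real power2_abs)
  qed
  have "(\<lambda>a. (cmod (e k a))\<^sup>2) sums 1"
    using has_sum_imp_sums[OF has_sum_ell2_norm_sq[OF spectral_decomposition_norm(1)[OF sd k]]]
      spectral_decomposition_norm(2)[OF sd k] by simp
  then have s: "?s \<longlonglongrightarrow> 1" by (simp add: sums_def)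
  have "(\<lambda>m. \<mu> k * (?s m)\<^sup>2) \<longlonglongrightarrow> \<mu> k * 1\<^sup>2" "(\<lambda>m. l * ?s m) \<longlonglongrightarrow> l * 1"
    by (intro tendsto_intros s)+
  then have "\<mu> k * 1\<^sup>2 \<le> l * 1"
    by (rule LIMSEQ_le) (use bound in auto)
  then show ?thesis by simp
qed

text \<open>The trace of the average state is the mean squared norm of the memory states, which are
  unit vectors.\<close>

lemma eigenvalues_total:
  assumes Q: "quantum_model M Q"
    and sd: "spectral_decomposition (system Q) (average_state M Q) e \<mu>"
  shows "(\<integral>\<^sup>+k. ennreal (\<mu> k) \<partial>count_space (system Q)) = 1"
proof -
  let ?r = "\<lambda>a. \<integral>p. (cmod (encoding Q p a))\<^sup>2 \<partial>past_law M"
  have "(\<integral>\<^sup>+k. ennreal (\<mu> k) \<partial>count_space (system Q)) = (\<integral>\<^sup>+a. ennreal (?r a) \<partial>count_space UNIV)"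
    by (rule spectral_decomposition_trace[OF sd])
      (simp add: average_state_def complex_norm_square[symmetric] del: of_real_power)
  also have "\<dots> = (\<integral>\<^sup>+a. \<integral>\<^sup>+p. ennreal ((cmod (encoding Q p a))\<^sup>2) \<partial>past_law M \<partial>count_space UNIV)"
  proof (rule nn_integral_cong)
    fix a
    have "integrable (past_law M) (\<lambda>p. (cmod (encoding Q p a))\<^sup>2)"
      using integrable_norm[OF encoding_integrable[OF Q, of a a]]
      by (simp add: norm_mult power2_eq_square)
    then show "ennreal (?r a) = (\<integral>\<^sup>+p. ennreal ((cmod (encoding Q p a))\<^sup>2) \<partial>past_law M)"
      by (rule nn_integral_eq_integral[symmetric]) simp
  qed
  also have "\<dots> = (\<integral>\<^sup>+p. \<integral>\<^sup>+a. ennreal ((cmod (encoding Q p a))\<^sup>2) \<partial>count_space UNIV \<partial>past_law M)"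
    using encoding_measurable[OF Q]
    by (intro nn_integral_count_space_nn_integral[symmetric]) auto
  also have "\<dots> = (\<integral>\<^sup>+p. 1 \<partial>past_law M)"
  proof (rule nn_integral_cong)
    fix p
    have "encoding Q p \<in> pure_states (system Q)"
      using Q by (auto simp: quantum_model_def)
    then have "((\<lambda>a. (cmod (encoding Q p a))\<^sup>2) has_sum 1) UNIV"
      using has_sum_ell2_norm_sq[of "encoding Q p" "system Q"] by (simp add: pure_states_def)
    then show "(\<integral>\<^sup>+a. ennreal ((cmod (encoding Q p a))\<^sup>2) \<partial>count_space UNIV) = 1"
      by (subst nn_integral_count_space_has_sum) auto
  qed
  also have "\<dots> = 1" using past.emeasure_space_1 by simp
  finally show ?thesis .
qed

lemma binary_entropy_le_model_entropy:
  assumes Q: "quantum_model M Q"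
    and gap: "\<And>d. (\<Sum>x<n. (\<Sum>i<n. \<pi> i * d i * sqrt (T i x))\<^sup>2) \<le> l * (\<Sum>i<n. \<pi> i * (d i)\<^sup>2)"
    and l: "1/2 \<le> l" "l < 1"
  shows "ennreal (binary_entropy l) \<le> model_entropy M Q"
  unfolding model_entropy_def von_neumann_entropy_def
proof (rule Inf_greatest, clarify)
  fix e \<mu> assume sd: "spectral_decomposition (system Q) (average_state M Q) e \<mu>"
  show "ennreal (binary_entropy l) \<le> (\<integral>\<^sup>+k. entropy_term (\<mu> k) \<partial>count_space (system Q))"
    using l eigenvalue_le[OF Q sd _ gap] spectral_decomposition_norm(3)[OF sd]
    by (intro binary_entropy_le_entropy eigenvalues_total[OF Q sd]) auto
qed

end

section \<open>A quantum model with memory states indexed by the last symbol\<close>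

lemma
  assumes "\<And>a. n \<le> a \<Longrightarrow> \<psi> a = 0"
  shows ell2_lessThan: "\<psi> \<in> ell2 {..<n}"
    and ell2_norm_sq_lessThan: "ell2_norm_sq \<psi> = (\<Sum>a<n. (cmod (\<psi> a))\<^sup>2)"
proof -
  have "((\<lambda>a. (cmod (\<psi> a))\<^sup>2) has_sum (\<Sum>a<n. (cmod (\<psi> a))\<^sup>2)) UNIV"
    using assms by (intro has_sum_finite_neutralI[of "{..<n}"]) auto
  then show "\<psi> \<in> ell2 {..<n}" "ell2_norm_sq \<psi> = (\<Sum>a<n. (cmod (\<psi> a))\<^sup>2)"
    using assms by (auto simp: ell2_def ell2_norm_sq_def has_sum_imp_summable infsumI)
qed

lemma ell2_lessThan_zero: "\<psi> \<in> ell2 {..<n} \<Longrightarrow> n \<le> a \<Longrightarrow> \<psi> a = 0"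
  by (auto simp: ell2_def)

lemma real_spectral_decomposition:
  assumes v: "\<And>k a. n \<le> a \<Longrightarrow> v k a = 0" and \<mu>: "\<And>k. k < n \<Longrightarrow> 0 \<le> \<mu> k"
    and orth: "\<And>k l. k < n \<Longrightarrow> l < n \<Longrightarrow> (\<Sum>a<n. v k a * v l a) = (if k = l then 1 else 0)"
    and R: "\<And>a b. (\<Sum>k<n. \<mu> k * v k a * v k b) = R a b"
  shows "spectral_decomposition {..<n} (\<lambda>a b. of_real (R a b)) (\<lambda>k a. of_real (v k a)) \<mu>"
  unfolding spectral_decomposition_def
proof (intro conjI ballI allI)
  fix k l assume "k \<in> {..<n}" "l \<in> {..<n}"
  have "((\<lambda>a. cnj (of_real (v k a)) * complex_of_real (v l a))
      has_sum (\<Sum>a<n. cnj (of_real (v k a)) * of_real (v l a))) UNIV"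
    using v by (intro has_sum_finite_neutralI[of "{..<n}"]) auto
  then have e: "ell2_inner (\<lambda>a. of_real (v k a)) (\<lambda>a. of_real (v l a)) = of_real (\<Sum>a<n. v k a * v l a)"
    by (simp add: ell2_inner_def infsumI)
  have o: "(\<Sum>a<n. v k a * v l a) = (if k = l then 1 else 0)"
    using orth \<open>k \<in> {..<n}\<close> \<open>l \<in> {..<n}\<close> by simp
  show "ell2_inner (\<lambda>a. of_real (v k a)) (\<lambda>a. of_real (v l a)) = (if k = l then 1 else 0)"
    unfolding e o by simp
next
  fix a b
  show "((\<lambda>k. complex_of_real (\<mu> k) * of_real (v k a) * cnj (of_real (v k b))) has_sum of_real (R a b)) {..<n}"
    unfolding R[symmetric] by (intro has_sum_finiteI) simp_all
qed (use v \<mu> in \<open>auto intro!: ell2_lessThan\<close>)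

context first_symbol_markov begin

lemma T_nonneg: "0 \<le> T i x"
  by (simp flip: next_symbol)

text \<open>The memory state of a past is \<open>\<Sum>x. sqrt (T i x) |x\<rangle>\<close>, where \<open>i\<close> is its last symbol;
  measuring \<open>x\<close> and preparing the memory state of \<open>x\<close> emits the next symbol.\<close>

definition q_machine :: "nat qmodel" where
  "q_machine = \<lparr>system = {..<n}, encoding = (\<lambda>p x. of_real (sqrt (T (p 0) x))),
     memory_states = range (\<lambda>i x. of_real (sqrt (T i x))),
     kraus = (\<lambda>x j \<psi> a. if j = 0 \<and> x < n then \<psi> x * of_real (sqrt (T x a)) else 0)\<rparr>"

lemma q_machine_norm:
  "ell2_norm_sq (\<lambda>a. c * of_real (sqrt (T i a))) = (cmod c)\<^sup>2"
proof -
  have "ell2_norm_sq (\<lambda>a. c * of_real (sqrt (T i a))) = (\<Sum>a<n. (cmod c)\<^sup>2 * T i a)"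
    using T_support T_nonneg by (subst ell2_norm_sq_lessThan[of n]) (auto simp: norm_mult power_mult_distrib)
  then show ?thesis using T_sum by (simp flip: sum_distrib_left)
qed

text \<open>Each outcome \<open>x\<close> below \<open>n\<close> has a single nonzero Kraus
  operator, at \<open>j = 0\<close>. It sends \<open>\<psi>\<close> to its amplitude at
  \<open>x\<close> times a unit vector, so the squared norms add up to that of
  \<open>\<psi>\<close>.\<close>

lemma quantum_instrument_q_machine: "quantum_instrument (system q_machine) (kraus q_machine)"
  unfolding quantum_instrument_def
proof (intro conjI allI ballI)
  fix x j
  show "ell2_operator (system q_machine) (kraus q_machine x j)"
    by (auto simp: ell2_operator_def q_machine_def algebra_simps T_support intro!: ell2_lessThan)
next
  fix \<psi> assume "\<psi> \<in> ell2 (system q_machine)"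
  then have \<psi>: "\<psi> a = 0" if "n \<le> a" for a
    using that by (auto simp: q_machine_def intro: ell2_lessThan_zero)
  have K: "ell2_norm_sq (kraus q_machine x j \<psi>) = (if j = 0 \<and> x < n then (cmod (\<psi> x))\<^sup>2 else 0)" for x j
    by (simp add: q_machine_def q_machine_norm) (simp add: ell2_norm_sq_def)
  have "(\<Sum>(x, j)\<in>{..<n} \<times> {0}. ell2_norm_sq (kraus q_machine x j \<psi>)) = ell2_norm_sq \<psi>"
    unfolding sum.cartesian_product[symmetric] using \<psi> by (simp add: K ell2_norm_sq_lessThan[of n])
  then show "((\<lambda>(x, j). ell2_norm_sq (kraus q_machine x j \<psi>)) has_sum ell2_norm_sq \<psi>) UNIV"
    by (intro has_sum_finite_neutralI[of "{..<n} \<times> {0}"]) (auto simp: K split: if_splits)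
qed

lemma quantum_model_q_machine: "quantum_model M q_machine"
  unfolding quantum_model_def
proof (intro conjI allI)
  have "ell2_norm_sq (\<lambda>a. of_real (sqrt (T i a))) = 1" for i
    using q_machine_norm[of 1 i] by simp
  then show "memory_states q_machine \<subseteq> pure_states (system q_machine)"
    by (auto simp: q_machine_def pure_states_def T_support intro!: ell2_lessThan)
  show "encoding q_machine p \<in> memory_states q_machine" for p
    by (auto simp: q_machine_def)
  show "(\<lambda>p. encoding q_machine p i) \<in> borel_measurable seq_space" for i
    by (auto simp: q_machine_def intro!: measurable_compose[OF measurable_seq_component])
  have j: "((\<lambda>j. if j = (0::nat) then c else 0) has_sum c) UNIV" for c :: "'c::topological_comm_monoid_add"
    by (rule has_sum_finite_neutralI[of "{0}"]) auto
  show "AE p in past_law M. \<forall>x.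
        ((\<lambda>j. ell2_norm_sq (kraus q_machine x j (encoding q_machine p))) has_sum cond_next M p x) UNIV \<and>
        (\<forall>a b. ((\<lambda>j. kraus q_machine x j (encoding q_machine p) a * cnj (kraus q_machine x j (encoding q_machine p) b)) has_sum
           of_real (cond_next M p x) *
             (encoding q_machine (append_past p x) a * cnj (encoding q_machine (append_past p x) b))) UNIV)"
    using AE_cond_next
  proof (elim AE_mp, intro AE_I2 impI allI conjI)
    fix p x assume "\<forall>x. cond_next M p x = T (p 0) x"
    then have c: "cond_next M p x = T (p 0) x" ..
    have n: "T (p 0) x = 0" if "\<not> x < n" using that T_support by simp
    have "ell2_norm_sq (kraus q_machine x j (encoding q_machine p)) = (if j = 0 then T (p 0) x else 0)" for j
      using n T_nonneg[of "p 0" x]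
      by (cases "x < n") (simp_all add: q_machine_def q_machine_norm ell2_norm_sq_def[of "\<lambda>_. 0"])
    then show "((\<lambda>j. ell2_norm_sq (kraus q_machine x j (encoding q_machine p))) has_sum cond_next M p x) UNIV"
      using j by (simp add: c)
    fix a b
    have "kraus q_machine x j (encoding q_machine p) a * cnj (kraus q_machine x j (encoding q_machine p) b)
      = (if j = 0 then of_real (T (p 0) x) *
          (encoding q_machine (append_past p x) a * cnj (encoding q_machine (append_past p x) b)) else 0)" for j
    proof -
      have "sqrt (T (p 0) x) * sqrt (T (p 0) x) = T (p 0) x" using T_nonneg by simp
      then have "complex_of_real (sqrt (T (p 0) x)) * of_real (sqrt (T (p 0) x)) = of_real (T (p 0) x)"
        by (metis of_real_mult)
      then show ?thesis
        using n by (auto simp: q_machine_def append_past_def)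
    qed
    then show "((\<lambda>j. kraus q_machine x j (encoding q_machine p) a * cnj (kraus q_machine x j (encoding q_machine p) b)) has_sum
           of_real (cond_next M p x) *
             (encoding q_machine (append_past p x) a * cnj (encoding q_machine (append_past p x) b))) UNIV"
      using j by (simp add: c)
  qed
qed (rule quantum_instrument_q_machine)

lemma integral_first_symbol:
  fixes h :: "nat \<Rightarrow> real"
  shows "(\<integral>p. h (p 0) \<partial>past_law M) = (\<Sum>i<n. \<pi> i * h i)"
proof -
  have m: "{q::nat \<Rightarrow> nat. q 0 = i} \<in> sets (past_law M)" for i by (simp add: sets_first)
  have h: "(\<lambda>p. h (p 0) * indicator {q. q 0 = i} p) = (\<lambda>p. h i * indicator {q. q 0 = i} p)" for i
    by (auto simp: fun_eq_iff indicator_def)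
  have "(\<integral>p. h (p 0) \<partial>past_law M)
      = (\<Sum>i<n. \<integral>p. h (p 0) * indicator {q. q 0 = i} p \<partial>past_law M)"
  proof (rule integral_split_first_symbol)
    show "(\<lambda>p. h (p 0)) \<in> borel_measurable seq_space"
      by (rule measurable_compose[OF measurable_seq_component]) simp
    show "integrable (past_law M) (\<lambda>p. h (p 0) * indicator {q. q 0 = i} p)" for i
      unfolding h using m
      by (intro integrable_mult_right) (simp add: integrable_indicator_iff past.emeasure_finite less_top[symmetric])
  qed
  also have "\<dots> = (\<Sum>i<n. \<pi> i * h i)"
    unfolding h using m \<pi>_pos
    by (intro sum.cong refl) (simp add: measure_def first_symbol less_imp_le)
  finally show ?thesis .
qed

text \<open>With \<open>A i x = sqrt (\<pi> i * T i x)\<close>, this is the matrix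
  \<open>A^T A\<close>.\<close>

lemma average_state_q_machine:
  "average_state M q_machine = (\<lambda>a b. of_real (\<Sum>i<n. \<pi> i * (sqrt (T i a) * sqrt (T i b))))"
proof (intro ext)
  fix a b
  have "average_state M q_machine a b
      = (\<integral>p. complex_of_real (sqrt (T (p 0) a) * sqrt (T (p 0) b)) \<partial>past_law M)"
    by (simp add: average_state_def q_machine_def)
  also have "\<dots> = of_real (\<integral>p. sqrt (T (p 0) a) * sqrt (T (p 0) b) \<partial>past_law M)"
    by (rule integral_complex_of_real)
  finally show "average_state M q_machine a b = of_real (\<Sum>i<n. \<pi> i * (sqrt (T i a) * sqrt (T i b)))"
    by (simp only: integral_first_symbol[of "\<lambda>i. sqrt (T i a) * sqrt (T i b)"])
qed

text \<open>In the coordinates \<open>sqrt (\<pi> i) * d i\<close>, the hypothesis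
  \<open>gap\<close> reads \<open>A A^T \<le> l\<close> as an inequality of quadratic forms and
  gives the lower bound for all models. The eigenvectors \<open>v k\<close> of \<open>A^T A\<close>
  show that \<open>q_machine\<close> attains it.\<close>

lemma is_quantum_complexityI:
  assumes gap: "\<And>d. (\<Sum>x<n. (\<Sum>i<n. \<pi> i * d i * sqrt (T i x))\<^sup>2) \<le> l * (\<Sum>i<n. \<pi> i * (d i)\<^sup>2)"
    and l: "1/2 \<le> l" "l < 1"
    and v: "\<And>k a. n \<le> a \<Longrightarrow> v k a = 0" and \<mu>: "\<And>k. k < n \<Longrightarrow> 0 \<le> \<mu> k"
    and orth: "\<And>k l. k < n \<Longrightarrow> l < n \<Longrightarrow> (\<Sum>a<n. v k a * v l a) = (if k = l then 1 else 0)"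
    and R: "\<And>a b. a < n \<Longrightarrow> b < n \<Longrightarrow>
      (\<Sum>k<n. \<mu> k * v k a * v k b) = (\<Sum>i<n. \<pi> i * (sqrt (T i a) * sqrt (T i b)))"
    and entropy: "(\<Sum>k<n. entropy_term (\<mu> k)) = ennreal (binary_entropy l)"
  shows "is_quantum_complexity M (ennreal (binary_entropy l))"
  unfolding is_quantum_complexity_def
proof (intro conjI allI impI exI[of _ q_machine])
  have "(\<Sum>k<n. \<mu> k * v k a * v k b) = (\<Sum>i<n. \<pi> i * (sqrt (T i a) * sqrt (T i b)))" for a b
    using R[of a b] by (cases "a < n \<and> b < n") (auto simp: v T_support not_less)
  note eq = this
  have sys: "system q_machine = {..<n}" by (simp add: q_machine_def)
  have sd: "spectral_decomposition (system q_machine) (average_state M q_machine) (\<lambda>k a. of_real (v k a)) \<mu>"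
    unfolding average_state_q_machine sys by (rule real_spectral_decomposition[OF v \<mu> orth eq])
  have "model_entropy M q_machine \<le> (\<integral>\<^sup>+k. entropy_term (\<mu> k) \<partial>count_space (system q_machine))"
    unfolding model_entropy_def von_neumann_entropy_def using sd by (intro Inf_lower) blast
  also have "\<dots> = ennreal (binary_entropy l)"
    by (simp add: sys nn_integral_count_space_finite entropy)
  finally show "model_entropy M q_machine = ennreal (binary_entropy l)"
    using binary_entropy_le_model_entropy[OF quantum_model_q_machine gap l] by (rule antisym)
qed (use binary_entropy_le_model_entropy gap l quantum_model_q_machine in auto)

end

section \<open>The two complexities of the process\<close>

interpretation forward: first_symbol_markov coin_process next_given forward_trans frequency 3
proof
  show "(\<Sum>x<3. forward_trans i x) = 1" for i
    by (simp add: lessThan_3 forward_trans_def)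
qed (auto simp: stochastic_coin_process regular_cond_future_coin_process next_given_first
    past_law_coin_process_first frequency_def forward_trans_def
    AE_frequency[OF past_law_coin_process_first])

interpretation backward: first_symbol_markov "reverse_process coin_process" previous_given backward_trans frequency 3
proof
  show "(\<Sum>x<3. backward_trans i x) = 1" for i
    by (simp add: lessThan_3 backward_trans_def frequency_def)
qed (auto simp: stochastic_reverse_process[OF stochastic_coin_process]
    regular_cond_future_reverse_coin_process previous_given_first
    past_law_reverse_coin_process_first frequency_def backward_trans_def
    AE_frequency[OF past_law_reverse_coin_process_first])

section \<open>Values of the classical complexities\<close>

lemma entropy_term_half: "entropy_term (1/2) = ennreal (1/2)"
  by (simp add: entropy_term_def log_divide)

lemma log2_four: "log 2 (4::real) = 2"
  using log_pow_cancel[of "2::real" 2] by simp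

lemma entropy_term_quarter: "entropy_term (1/4) = ennreal (1/2)"
  by (simp add: entropy_term_def log_divide log2_four)

lemma ennreal_half_add_half: "ennreal (1/2) + ennreal (1/2) = ennreal 1"
  by (rule trans[OF ennreal_plus[symmetric]]) simp_all

lemma statistical_complexity_coin_process: "statistical_complexity coin_process = ennreal 1"
proof -
  have ne: "next_given 0 \<noteq> next_given 2"
    using next_given_first[of 0 0] next_given_first[of 2 0] by (auto simp: forward_trans_def)
  have e: "next_given 1 = next_given 0" by (simp add: next_given_def)
  have "next_given ` {..<3} = {next_given 0, next_given 2}"
    using e by (simp add: lessThan_3)
  moreover have "{i. i < 3 \<and> next_given i = next_given 0} = {0, 1}"
    using ne e by (auto simp: less_Suc_eq numeral_3_eq_3 numeral_2_eq_2)
  moreover have "{i. i < 3 \<and> next_given i = next_given 2} = {2}"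
    using ne e by (auto simp: less_Suc_eq numeral_3_eq_3 numeral_2_eq_2)
  ultimately show ?thesis
    unfolding forward.statistical_complexity_eq using ne
    by (simp add: frequency_def entropy_term_half ennreal_half_add_half[simplified])
qed

lemma statistical_complexity_reverse_coin_process:
  "statistical_complexity (reverse_process coin_process) = ennreal (3/2)"
proof -
  \<comment> \<open>The three laws give the symbol 2 the probabilities 1, 0 and 1/2.\<close>
  have ne: "previous_given i \<noteq> previous_given j" if "i < 3" "j < 3" "i \<noteq> j" for i j
    using previous_given_first[of i 2] previous_given_first[of j 2] that
    by (auto simp: backward_trans_def frequency_def split: if_splits)
  then have inj: "inj_on previous_given {..<3}"
    unfolding inj_on_def by blast
  have "{i. i < 3 \<and> previous_given i = previous_given k} = {k}" if "k < 3" for k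
    using ne[of _ k] that by blast
  then have "statistical_complexity (reverse_process coin_process) = (\<Sum>k<3. entropy_term (frequency k))"
    unfolding backward.statistical_complexity_eq sum.reindex[OF inj] by simp
  also have "\<dots> = ennreal (1/2) + (ennreal (1/2) + ennreal (1/2))"
    by (simp add: lessThan_3 frequency_def entropy_term_half entropy_term_quarter)
  also have "\<dots> = ennreal (3/2)"
    unfolding ennreal_half_add_half by (rule trans[OF ennreal_plus[symmetric]]) simp_all
  finally show ?thesis .
qed

section \<open>Spectra of the average states and values of the quantum complexities\<close>

lemma sum_entropy_term_three_quarters:
  "(\<Sum>k<3. entropy_term (if k = 0 then 3/4 else if k = (1::nat) then 1/4 else 0)) = ennreal (binary_entropy (3/4))"
proof -
  have "0 \<le> - (3/4) * log 2 (3/4 :: real)" by simp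
  then show ?thesis
    unfolding binary_entropy_def
    by (simp add: lessThan_3 entropy_term_def log_divide log2_four flip: ennreal_plus)
qed

lemma is_quantum_complexity_coin_process:
  "is_quantum_complexity coin_process (ennreal (binary_entropy (3/4)))"
proof (rule forward.is_quantum_complexityI)
  fix d :: "nat \<Rightarrow> real"
  \<comment> \<open>The squares diagonalise \<open>3/4 - A A^T\<close> at the vector
    \<open>sqrt (frequency i) * d i\<close>. The eigenvalues 0 and 1/4 of \<open>A A^T\<close> give
    the weights 3/4 and 1/2, the former as 3/32 after normalising; the eigenvalue 3/4 gives weight
    zero.\<close>
  have "3/4 * (\<Sum>i<3. frequency i * (d i)\<^sup>2) - (\<Sum>x<3. (\<Sum>i<3. frequency i * d i * sqrt (forward_trans i x))\<^sup>2)
    = 3/32 * (d 0 - d 1)\<^sup>2 + 1/2 * ((d 0 + d 1) / 4 - d 2 / 2)\<^sup>2"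
    by (simp add: lessThan_3 frequency_def forward_trans_def real_sqrt_divide power_divide power2_eq_square field_simps)
  moreover have "\<dots> \<ge> 0" by simp
  ultimately show "(\<Sum>x<3. (\<Sum>i<3. frequency i * d i * sqrt (forward_trans i x))\<^sup>2) \<le> 3/4 * (\<Sum>i<3. frequency i * (d i)\<^sup>2)"
    by linarith
next
  let ?\<mu> = "\<lambda>k::nat. if k = 0 then 3/4 else if k = 1 then 1/4 else 0::real"
  \<comment> \<open>The average state is the equal mixture of the unit vectors (0,1,1) / sqrt 2 and
    (1,0,1) / sqrt 2. Their overlap is 1/2, whence the eigenvalues (1 + 1/2) / 2 and (1 - 1/2) / 2;
    the eigenvectors are their normalised sum and difference, and a vector orthogonal to
    both.\<close>
  let ?v = "\<lambda>k a::nat. if 3 \<le> a then 0 else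
    if k = 0 then (if a = 2 then 2 else 1) / sqrt 6
    else if k = 1 then (if a = 0 then 1 else if a = 1 then - 1 else 0) / sqrt 2
    else (if a = 2 then - 1 else 1) / sqrt 3"
  have r: "sqrt c * (b * sqrt c) = c * b" if "0 \<le> c" for b c :: real
    using that by (simp add: mult.left_commute mult.commute[of c])
  show "3 \<le> a \<Longrightarrow> ?v k a = 0" for k a by simp
  show "0 \<le> ?\<mu> k" for k by simp
  show "(\<Sum>a<3. ?v k a * ?v l a) = (if k = l then 1 else 0)" if "k < 3" "l < 3" for k l :: nat
    using that by (auto simp: lessThan_3 less_Suc_eq numeral_3_eq_3 numeral_2_eq_2)
  show "(\<Sum>k<3. ?\<mu> k * ?v k a * ?v k b)
      = (\<Sum>i<3. frequency i * (sqrt (forward_trans i a) * sqrt (forward_trans i b)))" if "a < 3" "b < 3" for a b :: nat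
    using that by (auto simp: lessThan_3 less_Suc_eq numeral_3_eq_3 numeral_2_eq_2 frequency_def forward_trans_def r)
  show "(\<Sum>k<3. entropy_term (?\<mu> k)) = ennreal (binary_entropy (3/4))" by (rule sum_entropy_term_three_quarters)
qed simp_all


lemma is_quantum_complexity_reverse_coin_process:
  "is_quantum_complexity (reverse_process coin_process) (ennreal (binary_entropy (3/4)))"
proof (rule backward.is_quantum_complexityI)
  fix d :: "nat \<Rightarrow> real"
  have r: "sqrt 2 * (sqrt 2 * c) = 2 * c" for c by (simp flip: mult.assoc)
  \<comment> \<open>With \<open>A\<close> transposed, the squares come from the forward eigenvectors
    (1,-1,0) / sqrt 2 and (1,1,-1) / sqrt 3 for the eigenvalues 1/4 and 0, with weights 1/2 and
    3/4.\<close>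
  have "3/4 * (\<Sum>i<3. frequency i * (d i)\<^sup>2) - (\<Sum>x<3. (\<Sum>i<3. frequency i * d i * sqrt (backward_trans i x))\<^sup>2)
    = 1/16 * (d 0 - d 1)\<^sup>2 + ((d 0 + d 1) / 4 - sqrt (1/2) * d 2 / 2)\<^sup>2"
    by (simp add: lessThan_3 frequency_def backward_trans_def real_sqrt_divide power_divide
        power2_eq_square field_simps r)
  moreover have "\<dots> \<ge> 0" by simp
  ultimately show "(\<Sum>x<3. (\<Sum>i<3. frequency i * d i * sqrt (backward_trans i x))\<^sup>2)
      \<le> 3/4 * (\<Sum>i<3. frequency i * (d i)\<^sup>2)"
    by linarith
next
  let ?\<mu> = "\<lambda>k::nat. if k = 0 then 3/4 else if k = 1 then 1/4 else 0::real"
  \<comment> \<open>These are the eigenvectors of the forward matrix \<open>A A^T\<close>, two of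
    which underlie the squares in the forward direction.\<close>
  let ?v = "\<lambda>k a::nat. if 3 \<le> a then 0 else
    if k = 0 then (if a = 2 then sqrt (1/2) else 1/2)
    else if k = 1 then (if a = 2 then - sqrt (1/2) else 1/2)
    else (if a = 0 then 1 else if a = 1 then - 1 else 0) / sqrt 2"
  show "3 \<le> a \<Longrightarrow> ?v k a = 0" for k a by simp
  show "0 \<le> ?\<mu> k" for k by simp
  show "(\<Sum>a<3. ?v k a * ?v l a) = (if k = l then 1 else 0)" if "k < 3" "l < 3" for k l :: nat
    using that by (auto simp: lessThan_3 less_Suc_eq numeral_3_eq_3 numeral_2_eq_2)
  show "(\<Sum>k<3. ?\<mu> k * ?v k a * ?v k b)
      = (\<Sum>i<3. frequency i * (sqrt (backward_trans i a) * sqrt (backward_trans i b)))" if "a < 3" "b < 3" for a b :: nat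
    using that by (auto simp: lessThan_3 less_Suc_eq numeral_3_eq_3 numeral_2_eq_2 frequency_def backward_trans_def
        real_sqrt_divide)
  show "(\<Sum>k<3. entropy_term (?\<mu> k)) = ennreal (binary_entropy (3/4))" by (rule sum_entropy_term_three_quarters)
qed simp_all

theorem mainTheorem1:
  "\<exists>M :: (int \<Rightarrow> nat) measure.
     stochastic_process M \<and> stationary M \<and>
     countably_many_causal_states M \<and> countably_many_causal_states (reverse_process M) \<and>
     statistical_complexity M \<noteq> statistical_complexity (reverse_process M) \<and>
     (\<exists>c < \<infinity>. is_quantum_complexity M c \<and> is_quantum_complexity (reverse_process M) c)"
proof (intro exI[of _ coin_process] conjI exI[of _ "ennreal (binary_entropy (3/4))"])
  show "statistical_complexity coin_process \<noteq> statistical_complexity (reverse_process coin_process)"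
    unfolding statistical_complexity_coin_process statistical_complexity_reverse_coin_process
    by (subst ennreal_inj) simp_all
qed (simp_all add: stochastic_coin_process stationary_coin_process forward.countably_many_causal_states
    backward.countably_many_causal_states is_quantum_complexity_coin_process
    is_quantum_complexity_reverse_coin_process)

end
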